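(* Let $n\ge 2$ and let $G_n=K_n\times K_2$ be the prism over the complete graph $K_n$, i.e. the graph with vertices $\{i^+,i^-:1\le i\le n\}$ and edges $i^+j^+$ and $i^-j^-$ for $1\le i<j\le n$ and $i^+i^-$ for $1\le i\le n$. Then the $(2n-3)$-dimensional total $2$-cut complex $\Delta^t_2(G_n)$ is homotopy equivalent to a wedge of $n-1$ spheres of dimension $2n-4$.
   Context: For a graph $G$, the total $2$-cut complex $\Delta_2^t(G)$ is the simplicial complex on $V(G)$ whose facets are the sets $V(G)\setminus\{a,b\}$ where $a\neq b$ and $ab$ is not an edge of $G$. *)

theory Defs
  imports "HOL-Analysis.Analysis"
begin

text \<open>A graph is given by its vertex set and its set of edges, each edge being a two-element
  set of vertices; a simplicial complex is given by its set of faces, the empty face included.\<close>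

definition total_2cut_facets :: "'a set \<Rightarrow> 'a set set \<Rightarrow> 'a set set" where
  "total_2cut_facets V E = {V - {a, b} | a b. a \<in> V \<and> b \<in> V \<and> a \<noteq> b \<and> {a, b} \<notin> E}"

definition total_2cut_complex :: "'a set \<Rightarrow> 'a set set \<Rightarrow> 'a set set" where
  "total_2cut_complex V E = {\<sigma>. \<exists>F \<in> total_2cut_facets V E. \<sigma> \<subseteq> F}"

text \<open>Meaningful for finite nonempty complexes only.\<close>

definition complex_dim :: "'a set set \<Rightarrow> int" where
  "complex_dim K = int (Max (card ` K)) - 1"

text \<open>Points are given by barycentric coordinates, extended by 0 to the whole type.
  On a finite complex the product topology agrees with the coherent (weak) topology.\<close>

definition geometric_realization :: "'a set set \<Rightarrow> ('a \<Rightarrow> real) topology" where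
  "geometric_realization K = subtopology (powertop_real UNIV)
     {x. (\<forall>v. 0 \<le> x v) \<and> {v. x v \<noteq> 0} \<in> K \<and> (\<Sum>v \<in> {v. x v \<noteq> 0}. x v) = 1}"

definition quotient_topology :: "'a topology \<Rightarrow> ('a \<Rightarrow> 'b) \<Rightarrow> 'b topology" where
  "quotient_topology X q =
     topology (\<lambda>U. U \<subseteq> q ` topspace X \<and> openin X {x \<in> topspace X. q x \<in> U})"

lemma istopology_quotient:
  "istopology (\<lambda>U. U \<subseteq> q ` topspace X \<and> openin X {x \<in> topspace X. q x \<in> U})"
proof -
  have int: "{x \<in> topspace X. q x \<in> S \<inter> T}
      = {x \<in> topspace X. q x \<in> S} \<inter> {x \<in> topspace X. q x \<in> T}" for S T
    by blast
  have un: "{x \<in> topspace X. q x \<in> \<Union>\<K>} = (\<Union>K\<in>\<K>. {x \<in> topspace X. q x \<in> K})" for \<K>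
    by blast
  show ?thesis
    unfolding istopology_def int un
    by (intro conjI allI impI openin_Int openin_Union) auto
qed

lemma openin_quotient_topology:
  "openin (quotient_topology X q) U \<longleftrightarrow>
     U \<subseteq> q ` topspace X \<and> openin X {x \<in> topspace X. q x \<in> U}"
  unfolding quotient_topology_def topology_inverse'[OF istopology_quotient] ..

lemma topspace_quotient_topology [simp]: "topspace (quotient_topology X q) = q ` topspace X"
proof
  show "topspace (quotient_topology X q) \<subseteq> q ` topspace X"
    using openin_topspace[of "quotient_topology X q"] unfolding openin_quotient_topology ..
  have "{x \<in> topspace X. q x \<in> q ` topspace X} = topspace X"
    by blast
  then have "openin (quotient_topology X q) (q ` topspace X)"
    by (simp add: openin_quotient_topology)
  then show "q ` topspace X \<subseteq> topspace (quotient_topology X q)"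
    by (rule openin_subset)
qed

lemma quotient_map_quotient_topology: "quotient_map X (quotient_topology X q) q"
  by (auto simp: quotient_map_def openin_quotient_topology)

text \<open>The wedge of a nonempty family of pointed spaces: in the disjoint union, all base points
  are identified to the single point \<open>None\<close>, and nothing else is.\<close>

definition wedge_proj :: "('i \<Rightarrow> 'a) \<Rightarrow> 'i \<times> 'a \<Rightarrow> ('i \<times> 'a) option" where
  "wedge_proj p = (\<lambda>(i, x). if x = p i then None else Some (i, x))"

definition wedge_topology ::
    "('i \<Rightarrow> 'a topology) \<Rightarrow> ('i \<Rightarrow> 'a) \<Rightarrow> 'i set \<Rightarrow> ('i \<times> 'a) option topology" where
  "wedge_topology X p I = quotient_topology (sum_topology X I) (wedge_proj p)"

definition wedge_of_spheres :: "nat \<Rightarrow> nat \<Rightarrow> (nat \<times> (nat \<Rightarrow> real)) option topology" where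
  "wedge_of_spheres m d =
     wedge_topology (\<lambda>_. nsphere d) (\<lambda>_ k. if k = 0 then 1 else 0) {..<m}"

text \<open>\<open>(i, True)\<close> stands for $i^+$ and \<open>(i, False)\<close> for $i^-$.\<close>

definition prism_verts :: "nat \<Rightarrow> (nat \<times> bool) set" where
  "prism_verts n = {1..n} \<times> UNIV"

definition prism_edges :: "nat \<Rightarrow> (nat \<times> bool) set set" where
  "prism_edges n =
     {{(i, s), (j, s)} | i j s. 1 \<le> i \<and> i < j \<and> j \<le> n} \<union>
     {{(i, True), (i, False)} | i. 1 \<le> i \<and> i \<le> n}"

end

theory Submission
  imports Defs
begin

text \<open>
  A face of the complex omits some \<open>i\<^sup>+\<close> and some \<open>j\<^sup>-\<close> with \<open>i \<noteq> j\<close>. Hence the complex is the sphere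
  \<open>\<partial>\<Delta> * \<partial>\<Delta>\<close> of dimension \<open>2n - 3\<close> with \<open>n\<close> open facets removed, and it is a deformation retract of
  the space \<open>\<real>\<^sup>n/\<real> \<times> \<real>\<^sup>n/\<real>\<close> with the \<open>n\<close> rays through the barycentres of these facets removed.
  A shear moves the rays into a plane, which leaves the complement of a planar star with \<open>n\<close> legs in
  \<open>\<real>\<^sup>2 \<times> \<real>\<^sup>q\<close>, where \<open>q = 2n - 4\<close>. The star divides the plane into \<open>n\<close> convex sectors. Collapsing the
  part over one of them to a point, and the boundary of the parts over each of the others,
  gives a map to a wedge of \<open>n - 1\<close> spheres of dimension \<open>q\<close>. The sphere attached to a sector is
  mapped back to a sphere that crosses the plane at the centre of that sector and at the centre
  of the base sector; both composites are homotopic to the identity along segments.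
\<close>

section \<open>Sectors of a planar star\<close>

lemma homotopic_with_top_of_setI:
  fixes h :: "real \<times> 'a::topological_space \<Rightarrow> 'b::topological_space"
  assumes "continuous_on ({0..1} \<times> S) h"
    and "\<And>t x. 0 \<le> t \<Longrightarrow> t \<le> 1 \<Longrightarrow> x \<in> S \<Longrightarrow> h (t, x) \<in> T"
    and "\<And>x. x \<in> S \<Longrightarrow> h (0, x) = f x" and "\<And>x. x \<in> S \<Longrightarrow> h (1, x) = g x"
  shows "homotopic_with (\<lambda>_. True) (top_of_set S) (top_of_set T) f g"
proof (subst homotopic_with, simp, intro exI conjI)
  show "continuous_map (prod_topology (top_of_set {0..1}) (top_of_set S)) (top_of_set T) h"
    using assms(1,2) by (auto simp: prod_topology_subtopology_eu)
qed (use assms in auto)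

text \<open>The spacing 2 leaves \<open>slope m k + 1\<close> as the middle direction of a sector,
  and the symmetry about 0 makes the slopes sum to 0.\<close>

definition slope :: "nat \<Rightarrow> nat \<Rightarrow> real" where
  "slope m k = 2 * real k - (real m - 1)"

definition star :: "nat \<Rightarrow> (real \<times> real) set" where
  "star m = {z. \<exists>s\<ge>0. z = (- s, 0) \<or> (\<exists>k<m. z = (s, s * slope m k))}"

text \<open>Positive on the \<open>k\<close>-th sector of the complement of the star. Writing it as a minimum of
  linear forms makes it concave, so segments towards the centre of a sector stay inside it.\<close>

definition sector :: "nat \<Rightarrow> nat \<Rightarrow> real \<times> real \<Rightarrow> real" where
  "sector m k z = min (snd z - slope m k * fst z)
     (if Suc k = m then snd z else slope m (Suc k) * fst z - snd z)"

text \<open>The sector between the negative axis and leg 0. It is kept apart because no sphere is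
  attached to it: its part of the complement collapses to the base point.\<close>

definition base_sector :: "nat \<Rightarrow> real \<times> real \<Rightarrow> real" where
  "base_sector m z = min (- snd z) (slope m 0 * fst z - snd z)"

lemma slope_Suc: "slope m (Suc k) = slope m k + 2"
  by (simp add: slope_def)

lemma slope_mono: "j \<le> k \<Longrightarrow> slope m j \<le> slope m k"
  by (simp add: slope_def)

lemma slope_last: "Suc k = m \<Longrightarrow> slope m k = real k"
  by (auto simp: slope_def)

lemma slope_mult_mono: "j \<le> k \<Longrightarrow> 0 \<le> s \<Longrightarrow> slope m j * s \<le> slope m k * s"
  by (simp add: mult_right_mono slope_mono)

section \<open>Disjointness of the sectors, and their union\<close>

lemma sector_pos_fst:
  assumes "0 < sector m k z" "Suc k \<noteq> m" shows "0 < fst z"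
  using assms by (auto simp: sector_def slope_Suc algebra_simps)

text \<open>The sector of smaller index is not the last one, so it lies in the right half-plane,
  where its upper leg is not above the lower leg of the other sector.\<close>

lemma sector_disjoint:
  assumes "0 < sector m j z" "0 < sector m k z" "j < m" "k < m" shows "j = k"
proof -
  have False if "0 < sector m j z" "0 < sector m k z" "j < k" "k < m" for j k
  proof -
    have "Suc j \<noteq> m" using that by simp
    then have "0 < fst z" using that(1) sector_pos_fst by blast
    then have "slope m (Suc j) * fst z \<le> slope m k * fst z"
      using that by (intro slope_mult_mono) auto
    then show False using that \<open>Suc j \<noteq> m\<close> by (auto simp: sector_def)
  qed
  then show ?thesis using assms by (meson linorder_neqE_nat)
qed

lemma base_sector_disjoint:
  assumes "0 < base_sector m z" "k < m" shows "sector m k z \<le> 0"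
proof (rule ccontr)
  assume "\<not> ?thesis"
  then have s: "0 < sector m k z" by simp
  then have "Suc k \<noteq> m" using assms(1) by (auto simp: sector_def base_sector_def)
  then have "0 < fst z" using s sector_pos_fst by blast
  then have "slope m 0 * fst z \<le> slope m k * fst z"
    by (intro slope_mult_mono) auto
  then show False using s assms(1) by (auto simp: sector_def base_sector_def)
qed

lemma star_sector_le:
  assumes "z \<in> star m" "k < m" shows "sector m k z \<le> 0"
proof -
  obtain s where s: "0 \<le> s" "z = (- s, 0) \<or> (\<exists>i<m. z = (s, s * slope m i))"
    using assms(1) by (auto simp: star_def)
  show ?thesis
    using s(2)
  proof (elim disjE exE conjE)
    assume z: "z = (- s, 0)"
    show ?thesis
    proof (cases "slope m k \<le> 0")
      case True
      then have "slope m k * s \<le> 0" using s(1) by (simp add: mult_nonpos_nonneg)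
      then show ?thesis by (simp add: sector_def z)
    next
      case False
      then have "0 \<le> slope m (Suc k) * s" using s(1) by (simp add: slope_Suc)
      then show ?thesis by (simp add: sector_def z min_le_iff_disj)
    qed
  next
    fix i assume i: "i < m" "z = (s, s * slope m i)"
    show ?thesis
    proof (cases "i \<le> k")
      case True
      then show ?thesis
        using slope_mult_mono[of i k s m] s(1) by (simp add: sector_def i mult.commute)
    next
      case False
      then show ?thesis
        using slope_mult_mono[of "Suc k" i s m] s(1) i(1) by (simp add: sector_def i(2) mult.commute)
    qed
  qed
qed

lemma star_base_sector_le:
  assumes "z \<in> star m" shows "base_sector m z \<le> 0"
  using assms slope_mult_mono[of 0 _ _ m]
  by (auto simp: star_def base_sector_def mult.commute min_le_iff_disj)

text \<open>When the minimum of two linear forms is 0, one form puts z on the line of a leg and the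
  sign of the other keeps it on the part in the star. Hence the denominators in
  \<open>stretch\<close> vanish only at removed points.\<close>

lemma sector_zero_star:
  assumes "sector m k z = 0" "k < m" shows "z \<in> star m"
proof -
  obtain a b where z: "z = (a, b)" by force
  show ?thesis
  proof (cases "b = slope m k * a")
    case True
    show ?thesis
    proof (cases "0 \<le> a")
      case a: True
      then show ?thesis using True assms(2) by (auto simp: star_def z mult.commute)
    next
      case False
      then have m: "Suc k = m"
        using assms(1) True by (auto simp: sector_def z slope_Suc algebra_simps split: if_splits)
      then have "b = 0"
        using assms(1) True False
        by (auto simp: sector_def z slope_last mult_nonneg_nonpos zero_le_mult_iff min_def split: if_splits)
      then show ?thesis using False by (auto simp: star_def z intro!: exI[of _ "-a"])
    qed
  next
    case False
    then have *: "(if Suc k = m then b else slope m (Suc k) * a - b) = 0" "b > slope m k * a"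
      using assms(1) by (auto simp: sector_def z min_def split: if_splits)
    show ?thesis
    proof (cases "Suc k = m")
      case True
      then have "b = 0" "real k * a < 0" using * by (auto simp: slope_last)
      then have "b = 0" "a \<le> 0" by (auto simp: mult_less_0_iff)
      then show ?thesis by (auto simp: star_def z intro!: exI[of _ "-a"])
    next
      case F: False
      then have "b = slope m (Suc k) * a" using * by simp
      then have "0 \<le> a" using *(2) by (simp add: slope_Suc algebra_simps)
      then show ?thesis using \<open>b = _\<close> F assms(2)
        by (auto simp: star_def z mult.commute intro!: exI[of _ a] exI[of _ "Suc k"])
    qed
  qed
qed

lemma sectors_cover:
  assumes "z \<notin> star m" "0 < m" shows "0 < base_sector m z \<or> (\<exists>k<m. 0 < sector m k z)"
proof (rule ccontr)
  assume "\<not> ?thesis"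
  then have bot: "base_sector m z \<le> 0" and sec: "\<And>k. k < m \<Longrightarrow> sector m k z \<le> 0"
    using linorder_not_less by blast+
  obtain a b where z: "z = (a, b)" by force
  have top: "min (b - real (m - 1) * a) b \<le> 0"
    using sec[of "m - 1"] assms(2) slope_last[of "m - 1" m] by (simp add: sector_def z)
  have sl0: "slope m 0 = - real (m - 1)" using assms(2) by (simp add: slope_def of_nat_diff)
  show False
  proof (cases "a \<le> 0")
    case True
    then have "real (m - 1) * a \<le> 0" by (simp add: mult_nonneg_nonpos)
    then have "b = 0"
      using top bot by (auto simp: base_sector_def z sl0)
    then show False using assms True by (auto simp: star_def z dest!: spec[of _ "-a"])
  next
    case False
    have ne: "b \<noteq> slope m k * a" if "k < m" for k
      using assms(1) that False by (auto simp: star_def z mult.commute)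
    \<comment> \<open>Moving up through the legs: being on no leg and in no sector forces z above
      each leg in turn, and finally into the last sector.\<close>
    have "k < m \<Longrightarrow> slope m k * a < b" for k
    proof (induction k)
      case 0
      have "0 \<le> real (m - 1) * a" using False by simp
      then have "slope m 0 * a \<le> b" using bot by (auto simp: base_sector_def z sl0)
      then show ?case using ne[OF 0] by simp
    next
      case (Suc k)
      then show ?case using sec[of k] ne[of "Suc k"] by (auto simp: sector_def z)
    qed
    from this[of "m - 1"] have "real (m - 1) * a < b"
      using assms(2) by (simp add: slope_def of_nat_diff)
    moreover have "0 \<le> real (m - 1) * a" using False by simp
    ultimately show False using top by linarith
  qed
qed

text \<open>The middle direction has vertical distance s to both adjacent legs. In the last sector
  the second form is s * m, which is at least s.\<close>

lemma sector_center:
  assumes "k < m" "0 \<le> s" shows "sector m k (s, s * (slope m k + 1)) = s"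
proof (cases "Suc k = m")
  case True
  then have "s * (slope m k + 1) = s * real m" by (auto simp: slope_def)
  moreover have "s * 1 \<le> s * real m" using assms by (intro mult_left_mono) auto
  moreover have "s * (slope m k + 1) - slope m k * s = s" by (simp add: algebra_simps)
  ultimately show ?thesis using True by (simp only: sector_def fst_conv snd_conv if_True simp_thms min_absorb1 mult_1_right)
qed (simp add: sector_def slope_Suc algebra_simps)

lemma min_concave:
  fixes s :: "'a::linordered_idom"
  assumes "0 \<le> s" "0 \<le> t"
  shows "s * min a b + t * min c d \<le> min (s * a + t * c) (s * b + t * d)"
  using assms by (intro min.boundedI add_mono mult_left_mono) auto

lemma sector_concave:
  assumes "0 \<le> s" "0 \<le> t"
  shows "s * sector m k x + t * sector m k y
    \<le> sector m k (s * fst x + t * fst y, s * snd x + t * snd y)"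
  unfolding sector_def by (rule order_trans[OF min_concave[OF assms]]) (auto simp: algebra_simps)

lemma base_sector_concave:
  assumes "0 \<le> s" "0 \<le> t"
  shows "s * base_sector m x + t * base_sector m y
    \<le> base_sector m (s * fst x + t * fst y, s * snd x + t * snd y)"
  unfolding base_sector_def by (rule order_trans[OF min_concave[OF assms]]) (auto simp: algebra_simps)

section \<open>The complement of a star\<close>

definition base_point :: "nat \<Rightarrow> real" where
  "base_point = (\<lambda>k. if k = 0 then 1 else 0)"

definition sphere_points :: "nat \<Rightarrow> (nat \<Rightarrow> real) set" where
  "sphere_points q = {x. (\<Sum>i\<le>q. x i ^ 2) = 1 \<and> (\<forall>i>q. x i = 0)}"

text \<open>The wedge is realised inside a product of spheres, as the points all but one of whose
  components are the base point; continuity can then be checked coordinatewise.\<close>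

definition wedge_emb :: "nat \<Rightarrow> nat \<Rightarrow> (nat \<Rightarrow> real) \<Rightarrow> nat \<times> nat \<Rightarrow> real" where
  "wedge_emb m k p = (\<lambda>(j, i). if j < m then (if j = k then p i else base_point i) else 0)"

definition wedge_points :: "nat \<Rightarrow> nat \<Rightarrow> (nat \<times> nat \<Rightarrow> real) set" where
  "wedge_points m q = {wedge_emb m k p | k p. k < m \<and> p \<in> sphere_points q}"

text \<open>The coordinates of \<open>w\<close> are indexed from 1 to q, so that index 0 is free for
  the additional coordinate of the sphere.\<close>

definition star_complement :: "nat \<Rightarrow> nat \<Rightarrow> ((real \<times> real) \<times> (nat \<Rightarrow> real)) set" where
  "star_complement m q =
     {(z, w). (\<forall>i. i = 0 \<or> q < i \<longrightarrow> w i = 0) \<and> (z \<in> star m \<longrightarrow> (\<exists>i. w i \<noteq> 0))}"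

definition norm_sq :: "nat \<Rightarrow> (nat \<Rightarrow> real) \<Rightarrow> real" where
  "norm_sq q w = (\<Sum>i=1..q. w i ^ 2)"

text \<open>For \<open>D \<ge> 0\<close> this doubles the angle of \<open>(D, w)\<close>, mapping a half-space onto the sphere with its
  boundary collapsed to the base point. For \<open>D < 0\<close> the summand \<open>max 0 (- D)\<close> keeps the
  denominator positive, so that the same formula is continuous and gives the base point.\<close>

definition stretch :: "nat \<Rightarrow> real \<Rightarrow> (nat \<Rightarrow> real) \<Rightarrow> nat \<Rightarrow> real" where
  "stretch q D w i =
     (let d = max 0 D; r = norm_sq q w + max 0 (- D)
      in if i = 0 then (r - d\<^sup>2) / (r + d\<^sup>2) else 2 * d * w i / (r + d\<^sup>2))"

definition to_wedge :: "nat \<Rightarrow> nat \<Rightarrow> (real \<times> real) \<times> (nat \<Rightarrow> real) \<Rightarrow> nat \<times> nat \<Rightarrow> real" where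
  "to_wedge m q x = (\<lambda>(k, i). if k < m then stretch q (sector m k (fst x)) (snd x) i else 0)"

text \<open>A point p of the k-th sphere is placed over the multiple - p 0 of (1,
  \<open>slope m k + 1\<close>) if p 0 < 0, and over (0, - p 0) in the base sector if p 0 > 0. Sums
  give one formula for all spheres because each summand vanishes at the base point; 1 minus the sum
  of the \<open>1 - y (k, 0)\<close> recovers p 0.\<close>

definition from_wedge :: "nat \<Rightarrow> (nat \<times> nat \<Rightarrow> real) \<Rightarrow> (real \<times> real) \<times> (nat \<Rightarrow> real)" where
  "from_wedge m y =
     ((\<Sum>k<m. max 0 (- y (k, 0)),
       (\<Sum>k<m. max 0 (- y (k, 0)) * (slope m k + 1)) - max 0 (1 - (\<Sum>k<m. 1 - y (k, 0)))),
      \<lambda>i. if i = 0 then 0 else \<Sum>k<m. y (k, i))"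

section \<open>Angle doubling and the maps between complement and wedge\<close>

lemma norm_sq_nonneg: "0 \<le> norm_sq q w"
  by (simp add: norm_sq_def sum_nonneg)

lemma norm_sq_eq_0: "norm_sq q w = 0 \<longleftrightarrow> (\<forall>i\<in>{1..q}. w i = 0)"
  by (simp add: norm_sq_def sum_nonneg_eq_0_iff)

lemma sum_sq_split: "(\<Sum>i\<le>q. w i ^ 2) = w 0 ^ 2 + norm_sq q w"
  unfolding norm_sq_def by (simp add: sum.atMost_shift sum.shift_bounds_cl_Suc_ivl atMost_atLeast0 sum.atLeast_Suc_atMost)

lemma base_point_sphere: "base_point \<in> sphere_points q"
  by (simp add: sphere_points_def base_point_def sum_sq_split norm_sq_def)

lemma wedge_emb_base: "wedge_emb m k base_point = wedge_emb m j base_point"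
  by (auto simp: wedge_emb_def fun_eq_iff)

lemma stretch_nonpos:
  assumes "D \<le> 0" "D \<noteq> 0 \<or> norm_sq q w \<noteq> 0"
  shows "stretch q D w = base_point"
proof -
  have "norm_sq q w + max 0 (- D) \<noteq> 0" using assms norm_sq_nonneg[of q w] by auto
  then show ?thesis using assms(1) by (auto simp: stretch_def base_point_def fun_eq_iff Let_def)
qed

lemma stretch_nonneg:
  assumes "0 \<le> D"
  shows "stretch q D w =
    (\<lambda>i. if i = 0 then (norm_sq q w - D\<^sup>2) / (norm_sq q w + D\<^sup>2) else 2 * D * w i / (norm_sq q w + D\<^sup>2))"
  using assms by (auto simp: stretch_def fun_eq_iff Let_def)

lemma stretch_sphere:
  assumes "D \<noteq> 0 \<or> norm_sq q w \<noteq> 0" "\<And>i. q < i \<Longrightarrow> w i = 0"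
  shows "stretch q D w \<in> sphere_points q"
proof (cases "D \<le> 0")
  case True
  then show ?thesis using assms base_point_sphere by (simp add: stretch_nonpos)
next
  case False
  define N where "N = norm_sq q w"
  have pos: "N + D\<^sup>2 > 0" using False norm_sq_nonneg[of q w] by (simp add: N_def add_nonneg_pos)
  have "norm_sq q (stretch q D w) = (2 * D / (N + D\<^sup>2))\<^sup>2 * N"
    using False unfolding norm_sq_def N_def
    by (simp add: stretch_nonneg sum_distrib_left power_mult_distrib power_divide norm_sq_def)
  moreover have "stretch q D w 0 = (N - D\<^sup>2) / (N + D\<^sup>2)"
    using False by (simp add: stretch_nonneg N_def)
  ultimately have "(\<Sum>i\<le>q. stretch q D w i ^ 2) = ((N - D\<^sup>2)\<^sup>2 + (2 * D)\<^sup>2 * N) / (N + D\<^sup>2)\<^sup>2"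
    unfolding sum_sq_split by (simp add: power_divide add_divide_distrib)
  also have "(N - D\<^sup>2)\<^sup>2 + (2 * D)\<^sup>2 * N = (N + D\<^sup>2)\<^sup>2"
    by (simp add: power2_eq_square algebra_simps)
  finally show ?thesis
    using pos assms(2) False by (auto simp: sphere_points_def stretch_nonneg)
qed

lemma star_complement_norm_sq:
  assumes "(z, w) \<in> star_complement m q" "norm_sq q w = 0"
  shows "w = (\<lambda>_. 0)" "z \<notin> star m"
proof -
  have "w i = 0" for i
    using assms by (cases "i = 0 \<or> q < i") (auto simp: star_complement_def norm_sq_eq_0)
  then show "w = (\<lambda>_. 0)" "z \<notin> star m"
    using assms(1) by (auto simp: star_complement_def)
qed

lemma star_complement_sector:
  assumes "(z, w) \<in> star_complement m q" "k < m"
  shows "sector m k z \<noteq> 0 \<or> norm_sq q w \<noteq> 0"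
  using star_complement_norm_sq(2)[OF assms(1)] sector_zero_star[OF _ assms(2)] by blast

text \<open>Every nonpositive sector contributes the base point. No sign is required of sector k
  itself, so points over the base sector or the star are covered with any k.\<close>

lemma to_wedge_eq_emb:
  assumes "(z, w) \<in> star_complement m q" "k < m"
    and "\<And>j. j < m \<Longrightarrow> j \<noteq> k \<Longrightarrow> sector m j z \<le> 0"
  shows "to_wedge m q (z, w) = wedge_emb m k (stretch q (sector m k z) w)"
  using assms stretch_nonpos[OF _ star_complement_sector[OF assms(1)]]
  by (auto simp: to_wedge_def wedge_emb_def fun_eq_iff)

lemma dominant_sector:
  assumes "0 < m"
  obtains k where "k < m" "\<And>j. j < m \<Longrightarrow> j \<noteq> k \<Longrightarrow> sector m j z \<le> 0"
proof (cases "\<exists>k<m. 0 < sector m k z")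
  case True
  then show ?thesis using that sector_disjoint by (metis not_le)
next
  case False
  then show ?thesis using that[of 0] assms linorder_not_less by blast
qed

lemma to_wedge_in:
  assumes "0 < m" "x \<in> star_complement m q" shows "to_wedge m q x \<in> wedge_points m q"
proof -
  obtain z w where x: "x = (z, w)" by (meson surj_pair)
  obtain k where k: "k < m" "\<And>j. j < m \<Longrightarrow> j \<noteq> k \<Longrightarrow> sector m j z \<le> 0"
    using dominant_sector[OF assms(1)] by blast
  have "stretch q (sector m k z) w \<in> sphere_points q"
    using assms(2) star_complement_sector[of z w m q k] k(1)
    by (intro stretch_sphere) (auto simp: star_complement_def x)
  then show ?thesis
    using to_wedge_eq_emb[OF _ k] assms(2) k(1) by (auto simp: x wedge_points_def)
qed

lemma from_wedge_emb:
  assumes "k < m"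
  shows "from_wedge m (wedge_emb m k p) =
    ((max 0 (- p 0), max 0 (- p 0) * (slope m k + 1) - max 0 (p 0)), \<lambda>i. if i = 0 then 0 else p i)"
proof -
  have *: "(\<Sum>j<m. g j (wedge_emb m k p (j, i))) = g k (p i)"
    if "\<And>j. g j (base_point i) = 0" for g :: "nat \<Rightarrow> real \<Rightarrow> real" and i
  proof -
    have "(\<Sum>j<m. g j (wedge_emb m k p (j, i))) = (\<Sum>j<m. if j = k then g k (p i) else 0)"
      using that by (intro sum.cong) (auto simp: wedge_emb_def)
    then show ?thesis using assms by simp
  qed
  show ?thesis
    using *[of "\<lambda>j x. max 0 (- x)" 0] *[of "\<lambda>j x. max 0 (- x) * (slope m j + 1)" 0]
      *[of "\<lambda>j x. 1 - x" 0] *[of "\<lambda>j x. x"]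
    by (auto simp: from_wedge_def base_point_def fun_eq_iff)
qed

lemma base_sector_center: "base_sector m (0, - s) = s"
  by (simp add: base_sector_def)

lemma from_wedge_in:
  assumes "y \<in> wedge_points m q" shows "from_wedge m y \<in> star_complement m q"
proof -
  obtain k p where k: "k < m" "p \<in> sphere_points q" and y: "y = wedge_emb m k p"
    using assms by (auto simp: wedge_points_def)
  let ?z = "(max 0 (- p 0), max 0 (- p 0) * (slope m k + 1) - max 0 (p 0))"
  \<comment> \<open>If the normal part vanishes, p is a pole, and the two poles lie over the centres
    of the base sector and of sector k, off the star.\<close>
  have "\<exists>i>0. p i \<noteq> 0" if "?z \<in> star m"
  proof (rule ccontr)
    assume "\<not> ?thesis"
    then have "p i = 0" if "i \<in> {1..q}" for i using that by (metis atLeastAtMost_iff less_le_trans zero_less_one)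
    then have "norm_sq q p = 0" by (simp add: norm_sq_eq_0)
    then have "(p 0)\<^sup>2 = 1" using k(2) by (simp add: sphere_points_def sum_sq_split)
    then have "p 0 = 1 \<or> p 0 = -1" by (simp add: power2_eq_1_iff)
    then show False
    proof
      assume "p 0 = 1"
      then show False using star_base_sector_le[OF that] base_sector_center[of m 1] by simp
    next
      assume "p 0 = -1"
      then show False using star_sector_le[OF that k(1)] sector_center[OF k(1), of 1] by simp
    qed
  qed
  then show ?thesis
    using k by (auto simp: star_complement_def y from_wedge_emb sphere_points_def split: if_splits)
qed

text \<open>For p 0 < 0 the denominator of \<open>stretch\<close> is the squared norm of p, which is
  1, and the hemisphere is spread over the whole sphere by angle doubling. The other hemisphere lies
  over no positive sector and collapses to the base point.\<close>

lemma to_from_wedge_emb: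
  assumes "k < m" "p \<in> sphere_points q"
  shows "to_wedge m q (from_wedge m (wedge_emb m k p)) = wedge_emb m k
    (\<lambda>i. if i = 0 then 1 - 2 * (max 0 (- p 0))\<^sup>2 else 2 * max 0 (- p 0) * p i)" (is "_ = wedge_emb m k ?p'")
proof -
  define z where "z = (max 0 (- p 0), max 0 (- p 0) * (slope m k + 1) - max 0 (p 0))"
  define w where "w = (\<lambda>i. if i = 0 then 0 else p i)"
  have eq: "from_wedge m (wedge_emb m k p) = (z, w)"
    using assms by (simp add: from_wedge_emb z_def w_def)
  have zw: "(z, w) \<in> star_complement m q"
    using from_wedge_in[of "wedge_emb m k p" m q] assms eq by (auto simp: wedge_points_def)
  have nrm: "(p 0)\<^sup>2 + norm_sq q w = 1"
    using assms(2) by (auto simp: sphere_points_def sum_sq_split norm_sq_def w_def)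
  have sec: "sector m j z \<le> 0" if "j < m" "j \<noteq> k \<or> 0 \<le> p 0" for j
  proof -
    consider "0 < p 0" | "p 0 = 0" | "p 0 < 0" by linarith
    then show ?thesis
    proof cases
      case 1
      then have "0 < base_sector m z" by (simp add: z_def base_sector_center)
      then show ?thesis using base_sector_disjoint that(1) by blast
    next
      case 2
      then show ?thesis by (simp add: z_def sector_def)
    next
      case 3
      then have "sector m k z = - p 0"
        using sector_center[OF assms(1), of "- p 0"] by (simp add: z_def)
      then show ?thesis using sector_disjoint[of m j z k] that assms(1) 3 by force
    qed
  qed
  have "stretch q (sector m k z) w = ?p'"
  proof (cases "0 \<le> p 0")
    case True
    then show ?thesis
      using stretch_nonpos[OF sec[OF assms(1)] star_complement_sector[OF zw assms(1)]]
      by (auto simp: base_point_def)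
  next
    case False
    then have s: "sector m k z = - p 0"
      using sector_center[OF assms(1), of "- p 0"] by (simp add: z_def)
    have n: "norm_sq q w = 1 - (p 0)\<^sup>2" using nrm by simp
    show ?thesis using False unfolding s by (auto simp: stretch_nonneg n fun_eq_iff) (auto simp: w_def)
  qed
  then show ?thesis
    using to_wedge_eq_emb[OF zw assms(1)] sec eq by simp
qed

section \<open>Continuity of the two maps\<close>

lemma continuous_on_snd_apply [continuous_intros]:
  "continuous_on S (\<lambda>x :: 'c::topological_space \<times> ('a \<Rightarrow> 'b::topological_space). snd x i)"
  by (rule continuous_on_product_then_coordinatewise) (intro continuous_intros)

lemma continuous_on_apply [continuous_intros]:
  "continuous_on S (\<lambda>x :: 'a \<Rightarrow> 'b::topological_space. x i)"
  by (rule continuous_on_product_then_coordinatewise) (intro continuous_intros)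

lemma continuous_on_sector [continuous_intros]:
  "continuous_on S f \<Longrightarrow> continuous_on S (\<lambda>x. sector m k (f x))"
  unfolding sector_def by (cases "Suc k = m") (auto intro!: continuous_intros)

lemma continuous_on_to_wedge: "continuous_on (star_complement m q) (to_wedge m q)"
proof (rule continuous_on_coordinatewise_then_product)
  fix ki :: "nat \<times> nat"
  obtain k i where ki: "ki = (k, i)" by force
  have "norm_sq q (snd x) + max 0 (- sector m k (fst x)) + (max 0 (sector m k (fst x)))\<^sup>2 \<noteq> 0"
    if "x \<in> star_complement m q" "k < m" for x
  proof -
    have "sector m k (fst x) \<noteq> 0 \<or> norm_sq q (snd x) \<noteq> 0"
      using star_complement_sector[of "fst x" "snd x"] that by simp
    then have "0 < norm_sq q (snd x) \<or> 0 < max 0 (- sector m k (fst x)) \<or> 0 < (max 0 (sector m k (fst x)))\<^sup>2"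
      using norm_sq_nonneg[of q "snd x"] by auto
    moreover have "0 \<le> norm_sq q (snd x)" "0 \<le> max 0 (- sector m k (fst x))" "0 \<le> (max 0 (sector m k (fst x)))\<^sup>2"
      using norm_sq_nonneg by auto
    ultimately show ?thesis by linarith
  qed
  then show "continuous_on (star_complement m q) (\<lambda>x. to_wedge m q x ki)"
    unfolding to_wedge_def ki prod.case stretch_def Let_def norm_sq_def
    by (cases "k < m"; cases "i = 0") (auto intro!: continuous_intros)
qed

lemma continuous_on_from_wedge: "continuous_on S (from_wedge m)"
proof -
  have "continuous_on S (\<lambda>y i. if i = 0 then 0 else \<Sum>k<m. (y :: nat \<times> nat \<Rightarrow> real) (k, i))"
  proof (rule continuous_on_coordinatewise_then_product)
    show "continuous_on S (\<lambda>y. if i = 0 then 0 else \<Sum>k<m. (y :: nat \<times> nat \<Rightarrow> real) (k, i))" for i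
      by (cases "i = 0") (auto intro!: continuous_intros)
  qed
  then show ?thesis
    unfolding from_wedge_def by (intro continuous_on_Pair) (auto intro!: continuous_intros)
qed

section \<open>The two homotopies along segments\<close>

lemma to_wedge_snd_scale:
  assumes "x \<in> star_complement m q"
  obtains c where "0 \<le> c" "snd (from_wedge m (to_wedge m q x)) = (\<lambda>i. c * snd x i)"
proof
  define g where "g k = norm_sq q (snd x) + max 0 (- sector m k (fst x)) + (max 0 (sector m k (fst x)))\<^sup>2" for k
  \<comment> \<open>All coordinates of \<open>stretch\<close> other than 0 are the same nonnegative
    multiple of \<open>w\<close>, so the composite merely rescales \<open>w\<close>.\<close>
  let ?c = "\<Sum>k<m. 2 * max 0 (sector m k (fst x)) / g k"
  show "0 \<le> ?c"
    by (intro sum_nonneg divide_nonneg_nonneg) (auto simp: g_def norm_sq_nonneg intro!: add_nonneg_nonneg)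
  show "snd (from_wedge m (to_wedge m q x)) = (\<lambda>i. ?c * snd x i)"
  proof
    fix i
    show "snd (from_wedge m (to_wedge m q x)) i = ?c * snd x i"
    proof (cases "i = 0")
      case True
      then have "snd x i = 0" using assms by (auto simp: star_complement_def)
      then show ?thesis using True by (simp add: from_wedge_def)
    next
      case False
      then have "snd (from_wedge m (to_wedge m q x)) i
          = (\<Sum>k<m. 2 * max 0 (sector m k (fst x)) * snd x i / g k)"
        by (simp add: from_wedge_def to_wedge_def stretch_def Let_def g_def)
      then show ?thesis by (simp add: sum_distrib_right)
    qed
  qed
qed

lemma not_star_iff_sector:
  assumes "0 < m"
  shows "z \<notin> star m \<longleftrightarrow> 0 < base_sector m z \<or> (\<exists>k<m. 0 < sector m k z)"
  using sectors_cover[OF _ assms] star_sector_le star_base_sector_le by (metis not_le)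

text \<open>For t > 0 a nonzero \<open>w\<close> is multiplied by a positive factor. Where
  \<open>w\<close> is 0, the composite moves z to the centre of its own sector, and concavity keeps
  the segment in that sector.\<close>

lemma from_to_wedge_segment:
  assumes "0 < m" and x: "x \<in> star_complement m q" and t: "0 \<le> t" "t \<le> 1"
  defines "y \<equiv> from_wedge m (to_wedge m q x)"
  shows "(((1 - t) * fst (fst y) + t * fst (fst x), (1 - t) * snd (fst y) + t * snd (fst x)),
           \<lambda>i. (1 - t) * snd y i + t * snd x i) \<in> star_complement m q" (is "(?z, ?w) \<in> _")
proof (cases "t = 0")
  case True
  \<comment> \<open>At t = 0 the factor of \<open>w\<close> may vanish, so membership is taken from
    the composite itself.\<close>
  have "y \<in> star_complement m q"
    unfolding y_def using assms(1) x by (intro from_wedge_in to_wedge_in)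
  then show ?thesis using True by simp
next
  case False
  obtain z w where zw: "x = (z, w)" by (meson surj_pair)
  obtain c where c: "0 \<le> c" "snd y = (\<lambda>i. c * snd x i)"
    unfolding y_def using to_wedge_snd_scale[OF x] by blast
  have w: "?w = (\<lambda>i. ((1 - t) * c + t) * w i)"
    by (simp add: c zw algebra_simps)
  have pos: "0 < (1 - t) * c + t" using False c(1) t by (simp add: add_nonneg_pos)
  have "?z \<notin> star m" if 0: "w = (\<lambda>_. 0)"
  proof -
    have ns: "z \<notin> star m" using x 0 by (auto simp: star_complement_def zw)
    then consider (base) "0 < base_sector m z" | (sector) k where "k < m" "0 < sector m k z"
      using not_star_iff_sector[OF assms(1)] by blast
    then show ?thesis
    proof cases
      case base
      then have sec: "sector m j z \<le> 0" if "j < m" for j using base_sector_disjoint that by blast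
      then have "to_wedge m q x = wedge_emb m 0 base_point"
        using to_wedge_eq_emb[of z w m q 0] x assms(1) stretch_nonpos[OF _ star_complement_sector[of z w m q 0]]
        by (simp add: zw)
      then have "fst y = (0, -1)"
        using assms(1) by (simp add: y_def from_wedge_emb base_point_def)
      then have "(1 - t) * base_sector m (0, -1) + t * base_sector m z \<le> base_sector m ?z"
        using base_sector_concave[of "1 - t" t m "fst y" z] t by (simp add: zw)
      moreover have "0 < (1 - t) * base_sector m (0, -1) + t * base_sector m z"
        using base False t base_sector_center[of m 1] by (intro add_nonneg_pos) auto
      ultimately show ?thesis
        using not_star_iff_sector[OF assms(1)] by force
    next
      case sector
      then have sec: "sector m j z \<le> 0" if "j < m" "j \<noteq> k" for j
        using sector_disjoint that not_le by metis
      then have "to_wedge m q x = wedge_emb m k (stretch q (sector m k z) w)"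
        using to_wedge_eq_emb[of z w m q k] x sector by (simp add: zw)
      moreover have "stretch q (sector m k z) w 0 = -1"
        using sector(2) by (simp add: stretch_nonneg 0 norm_sq_def)
      ultimately have "fst y = (1, 1 * (slope m k + 1))"
        using sector(1) by (simp add: y_def from_wedge_emb)
      then have "sector m k (fst y) = 1" using sector_center[OF sector(1), of 1] by simp
      then have "(1 - t) * 1 + t * sector m k z \<le> sector m k ?z"
        using sector_concave[of "1 - t" t m k "fst y" z] t by (simp add: zw)
      moreover have "0 < (1 - t) * 1 + t * sector m k z"
        using sector False t by (intro add_nonneg_pos) auto
      ultimately show ?thesis
        using not_star_iff_sector[OF assms(1)] sector(1) by force
    qed
  qed
  then show ?thesis
    using x pos unfolding w by (auto simp: star_complement_def zw)
qed

text \<open>Beyond index 0 the segment has positive multiples of the coordinates of p, unless t = 0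
  and p 0 >= 0, where it is at the base point. A zero would thus make p a pole, but both poles are
  fixed by the passage from p to p'.\<close>

lemma wedge_segment_nonzero:
  assumes p: "p \<in> sphere_points q" and t: "0 \<le> t" "t \<le> 1"
  defines "p' \<equiv> \<lambda>i. if i = 0 then 1 - 2 * (max 0 (- p 0))\<^sup>2 else 2 * max 0 (- p 0) * p i"
  shows "(\<Sum>i\<le>q. ((1 - t) * p' i + t * p i)\<^sup>2) \<noteq> 0"
proof
  assume 0: "(\<Sum>i\<le>q. ((1 - t) * p' i + t * p i)\<^sup>2) = 0"
  have z: "(1 - t) * p' i + t * p i = 0" if "i \<le> q" for i
    using 0 that by (simp add: sum_nonneg_eq_0_iff)
  have "p 0 \<ge> 0 \<Longrightarrow> t = 0 \<Longrightarrow> False"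
    using z[of 0] by (simp add: p'_def)
  moreover have "((1 - t) * (2 * max 0 (- p 0)) + t) * p i = 0" if "i \<in> {1..q}" for i
    using z[of i] that by (simp add: p'_def algebra_simps)
  moreover have "0 < (1 - t) * (2 * max 0 (- p 0)) + t" if "\<not> (p 0 \<ge> 0 \<and> t = 0)"
    using that t by (cases "t = 0") (auto intro!: add_nonneg_pos)
  ultimately have "norm_sq q p = 0"
    by (metis norm_sq_eq_0 mult_eq_0_iff less_irrefl)
  then have "(p 0)\<^sup>2 = 1" using p by (simp add: sphere_points_def sum_sq_split)
  then have "p 0 = 1 \<or> p 0 = -1" by (simp add: power2_eq_1_iff)
  then show False using z[of 0] by (auto simp: p'_def)
qed

lemma star_complement_homotopy_equivalent_wedge:
  assumes "0 < m"
  shows "top_of_set (star_complement m q) homotopy_equivalent_space top_of_set (wedge_points m q)"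
  unfolding homotopy_equivalent_space_def
proof (intro exI conjI)
  let ?E = "star_complement m q" and ?W = "wedge_points m q"
  show "continuous_map (top_of_set ?E) (top_of_set ?W) (to_wedge m q)"
    using continuous_on_to_wedge to_wedge_in[OF assms] by auto
  show "continuous_map (top_of_set ?W) (top_of_set ?E) (from_wedge m)"
    using continuous_on_from_wedge from_wedge_in by auto
  show "homotopic_with (\<lambda>x. True) (top_of_set ?E) (top_of_set ?E) (from_wedge m \<circ> to_wedge m q) id"
  proof (rule homotopic_with_top_of_setI)
    define y where "y = (\<lambda>a :: real \<times> (real \<times> real) \<times> (nat \<Rightarrow> real). from_wedge m (to_wedge m q (snd a)))"
    let ?h = "\<lambda>a. (((1 - fst a) * fst (fst (y a)) + fst a * fst (fst (snd a)),
       (1 - fst a) * snd (fst (y a)) + fst a * snd (fst (snd a))),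
           \<lambda>i. (1 - fst a) * snd (y a) i + fst a * snd (snd a) i)"
    have y: "continuous_on ({0..1} \<times> ?E) y"
      unfolding y_def
      by (intro continuous_on_compose2[OF continuous_on_from_wedge] continuous_on_compose2[OF continuous_on_to_wedge])
        (auto intro!: continuous_intros)
    show "continuous_on ({0..1} \<times> ?E) ?h"
      by (intro continuous_intros y continuous_on_coordinatewise_then_product
        continuous_on_product_then_coordinatewise[where f = "\<lambda>a. snd (y a)"]
        continuous_on_product_then_coordinatewise[where f = "\<lambda>a. snd (snd a)"])
    show "?h (t, x) \<in> ?E" if "0 \<le> t" "t \<le> 1" "x \<in> ?E" for t x
      using from_to_wedge_segment[OF assms that(3,1,2)] by (simp add: y_def)
    show "?h (0, x) = (from_wedge m \<circ> to_wedge m q) x" "?h (1, x) = id x" for x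
      by (simp_all add: y_def)
  qed
  show "homotopic_with (\<lambda>x. True) (top_of_set ?W) (top_of_set ?W) (to_wedge m q \<circ> from_wedge m) id"
  proof (rule homotopic_with_top_of_setI)
    \<comment> \<open>Each component is interpolated linearly and renormalised to the sphere. All
      components but one interpolate the base point with itself, so the path stays in the
      wedge.\<close>
    define u where "u = (\<lambda>(a :: real \<times> (nat \<times> nat \<Rightarrow> real)) v.
       (1 - fst a) * to_wedge m q (from_wedge m (snd a)) v + fst a * snd a v)"
    define h where "h = (\<lambda>a (k, i). if k < m then u a (k, i) / sqrt (\<Sum>j\<le>q. (u a (k, j))\<^sup>2) else 0)"
    have h_emb: "\<exists>r. (\<Sum>i\<le>q. (r i)\<^sup>2) \<noteq> 0 \<and> (\<forall>i>q. r i = 0) \<and>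
        h (t, wedge_emb m k p) = wedge_emb m k (\<lambda>i. r i / sqrt (\<Sum>i\<le>q. (r i)\<^sup>2)) \<and>
        (\<forall>j<m. (\<Sum>i\<le>q. (u (t, wedge_emb m k p) (j, i))\<^sup>2) \<noteq> 0)"
      if "k < m" "p \<in> sphere_points q" "0 \<le> t" "t \<le> 1" for k p t
    proof -
      define p' where "p' = (\<lambda>i. if i = 0 then 1 - 2 * (max 0 (- p 0))\<^sup>2 else 2 * max 0 (- p 0) * p i)"
      define r where "r = (\<lambda>i. (1 - t) * p' i + t * p i)"
      have tf: "to_wedge m q (from_wedge m (wedge_emb m k p)) = wedge_emb m k p'"
        unfolding p'_def by (rule to_from_wedge_emb[OF that(1,2)])
      have u: "u (t, wedge_emb m k p) (j, i) = (if j = k then r i else base_point i)" if "j < m" for i j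
        using that by (simp add: u_def tf) (simp add: wedge_emb_def r_def algebra_simps)
      have base: "(\<Sum>i\<le>q. (base_point i)\<^sup>2) = 1"
        using base_point_sphere by (simp add: sphere_points_def)
      have r: "(\<Sum>i\<le>q. (r i)\<^sup>2) \<noteq> 0"
        unfolding r_def p'_def by (rule wedge_segment_nonzero[OF that(2,3,4)])
      have "h (t, wedge_emb m k p) (j, i) = wedge_emb m k (\<lambda>i. r i / sqrt (\<Sum>i\<le>q. (r i)\<^sup>2)) (j, i)" for j i
        by (cases "j < m"; cases "j = k") (simp_all add: h_def u base, simp_all add: wedge_emb_def)
      then have "h (t, wedge_emb m k p) = wedge_emb m k (\<lambda>i. r i / sqrt (\<Sum>i\<le>q. (r i)\<^sup>2))"
        by auto
      moreover have "\<forall>i>q. r i = 0"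
        using that(2) by (auto simp: r_def p'_def sphere_points_def)
      moreover have "\<forall>j<m. (\<Sum>i\<le>q. (u (t, wedge_emb m k p) (j, i))\<^sup>2) \<noteq> 0"
      proof (intro allI impI)
        show "(\<Sum>i\<le>q. (u (t, wedge_emb m k p) (j, i))\<^sup>2) \<noteq> 0" if "j < m" for j
          using r base that by (cases "j = k") (simp_all add: u)
      qed
      ultimately show ?thesis using r by metis
    qed
    have u: "continuous_on ({0..1} \<times> ?W) (\<lambda>a. u a v)" for v
    proof -
      have "continuous_on ({0..1} \<times> ?W) (\<lambda>a. to_wedge m q (from_wedge m (snd a)))"
        using from_wedge_in
        by (intro continuous_on_compose2[OF continuous_on_to_wedge]
          continuous_on_compose2[OF continuous_on_from_wedge]) (auto intro!: continuous_intros)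
      from continuous_on_product_then_coordinatewise[OF this] show ?thesis
        unfolding u_def by (intro continuous_intros)
    qed
    show "continuous_on ({0..1} \<times> ?W) h"
    proof (rule continuous_on_coordinatewise_then_product)
      fix v :: "nat \<times> nat"
      obtain k i where v: "v = (k, i)" by force
      have "(\<Sum>j\<le>q. (u a (k, j))\<^sup>2) \<noteq> 0" if km: "k < m" and a: "a \<in> {0..1} \<times> ?W" for a
      proof -
        obtain t l p where "a = (t, wedge_emb m l p)" "0 \<le> t" "t \<le> 1" "l < m" "p \<in> sphere_points q"
          using a by (auto simp: wedge_points_def)
        then show ?thesis using h_emb[of l p t] km by blast
      qed
      then show "continuous_on ({0..1} \<times> ?W) (\<lambda>a. h a v)"
        unfolding v h_def prod.case by (cases "k < m") (auto intro!: continuous_intros u)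
    qed
    have sphere: "(\<lambda>i. r i / sqrt (\<Sum>i\<le>q. (r i)\<^sup>2)) \<in> sphere_points q"
      if "(\<Sum>i\<le>q. (r i)\<^sup>2) \<noteq> 0" "\<forall>i>q. r i = 0" for r :: "nat \<Rightarrow> real"
    proof -
      have "0 \<le> (\<Sum>i\<le>q. (r i)\<^sup>2)" by (simp add: sum_nonneg)
      then show ?thesis
        using that by (simp add: sphere_points_def power_divide flip: sum_divide_distrib)
    qed
    show "h (t, y) \<in> ?W" if t: "0 \<le> t" "t \<le> 1" and y: "y \<in> ?W" for t y
    proof -
      obtain k p where "k < m" "p \<in> sphere_points q" "y = wedge_emb m k p"
        using y by (auto simp: wedge_points_def)
      then show ?thesis using h_emb[of k p t] sphere t unfolding wedge_points_def by blast
    qed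
    \<comment> \<open>Renormalising changes nothing at the two ends, where the components are
      already unit vectors.\<close>
    have one: "h (t, y) = g y" if eq: "\<And>v. u (t, y) v = g y v" and g: "g y \<in> ?W" for t y and g :: "_ \<Rightarrow> nat \<times> nat \<Rightarrow> real"
    proof -
      obtain k p where kp: "k < m" "p \<in> sphere_points q" "g y = wedge_emb m k p"
        using g by (auto simp: wedge_points_def)
      have base: "(\<Sum>i\<le>q. (base_point i)\<^sup>2) = 1"
        using base_point_sphere by (simp add: sphere_points_def)
      have "h (t, y) (j, i) = g y (j, i)" for j i
        using kp(2) by (cases "j < m"; cases "j = k")
          (simp_all add: h_def eq kp(3), simp_all add: wedge_emb_def base sphere_points_def)
      then show ?thesis by auto
    qed
    show "h (0, y) = (to_wedge m q \<circ> from_wedge m) y" if "y \<in> ?W" for y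
      using that to_wedge_in[OF assms from_wedge_in] by (intro one) (auto simp: u_def)
    show "h (1, y) = id y" if "y \<in> ?W" for y
      using that by (intro one) (auto simp: u_def)
  qed
qed

section \<open>The wedge of spheres\<close>

lemma nsphere_eq_top_of_set: "nsphere q = top_of_set (sphere_points q)"
  by (simp add: nsphere sphere_points_def euclidean_product_topology)

text \<open>A closed subset of the cube with sides [-1, 1], which is compact by Tychonoff.\<close>

lemma compact_sphere_points: "compact (sphere_points q)"
proof -
  have "closed (sphere_points q)"
    unfolding sphere_points_def
    by (intro closed_Collect_conj closed_Collect_all closed_Collect_imp closed_Collect_eq open_Collect_const continuous_intros)
  moreover have "compact (PiE UNIV (\<lambda>_ :: nat. {-1..1 :: real}))"
  proof -
    have "compactin (powertop_real UNIV) (PiE UNIV (\<lambda>_ :: nat. {-1..1 :: real}))"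
      by (simp add: compactin_PiE)
    then show ?thesis by (simp add: euclidean_product_topology)
  qed
  moreover have "sphere_points q \<subseteq> PiE UNIV (\<lambda>_. {-1..1})"
  proof
    fix x assume x: "x \<in> sphere_points q"
    have "\<bar>x i\<bar> \<le> 1" for i
    proof (cases "i \<le> q")
      case True
      then have "(x i)\<^sup>2 \<le> (\<Sum>i\<le>q. (x i)\<^sup>2)" by (intro member_le_sum) auto
      then show ?thesis using x by (simp add: sphere_points_def abs_square_le_1)
    qed (use x in \<open>auto simp: sphere_points_def\<close>)
    then show "x \<in> PiE UNIV (\<lambda>_. {-1..1})" by (auto simp: abs_le_iff)
  qed
  ultimately show ?thesis
    by (metis compact_Int_closed inf.absorb_iff2)
qed

lemma continuous_on_wedge_emb: "continuous_on S (wedge_emb m k)"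
proof (rule continuous_on_coordinatewise_then_product)
  fix v :: "nat \<times> nat"
  obtain j i where "v = (j, i)" by force
  then show "continuous_on S (\<lambda>p. wedge_emb m k p v)"
    by (cases "j < m"; cases "j = k") (auto simp: wedge_emb_def intro!: continuous_intros)
qed

text \<open>Components j and k decide: if j and k differ, each of them is the base point on one
  side. These are the identifications made by \<open>wedge_proj\<close>, whence injectivity on the
  quotient.\<close>

lemma wedge_emb_eqD:
  assumes "wedge_emb m j p = wedge_emb m k p'" "j < m" "k < m"
  shows "(j = k \<and> p = p') \<or> (p = base_point \<and> p' = base_point)"
proof -
  have "wedge_emb m j p (j, i) = wedge_emb m k p' (j, i)" "wedge_emb m j p (k, i) = wedge_emb m k p' (k, i)" for i
    using assms(1) by auto
  then show ?thesis using assms(2,3) by (cases "j = k") (auto simp: wedge_emb_def fun_eq_iff)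
qed

lemma compact_space_wedge_of_spheres: "compact_space (wedge_of_spheres m q)"
proof -
  let ?S = "sum_topology (\<lambda>_ :: nat. nsphere q) {..<m}"
  have "compactin ?S (Pair k ` topspace (nsphere q))" if "k < m" for k
  proof (rule image_compactin)
    show "compactin (nsphere q) (topspace (nsphere q))"
      using compact_sphere_points by (simp add: nsphere_eq_top_of_set compactin_subtopology)
    show "continuous_map (nsphere q) ?S (Pair k)"
      using continuous_map_component_injection[of k "{..<m}" "\<lambda>_. nsphere q"] that by simp
  qed
  then have "compactin ?S (\<Union>k\<in>{..<m}. Pair k ` topspace (nsphere q))"
    by (intro compactin_Union) auto
  also have "(\<Union>k\<in>{..<m}. Pair k ` topspace (nsphere q)) = topspace ?S"
    by auto
  finally have "compact_space ?S" by (simp add: compact_space_def)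
  from image_compactin[OF this[unfolded compact_space_def]
      quotient_imp_continuous_map[OF quotient_map_quotient_topology]]
  show ?thesis
    unfolding wedge_of_spheres_def wedge_topology_def compact_space_def topspace_quotient_topology .
qed

text \<open>A continuous bijection from a compact space to a Hausdorff space is a homeomorphism,
  which avoids a direct study of the inverse.\<close>

lemma wedge_of_spheres_homeomorphic:
  assumes "0 < m"
  shows "wedge_of_spheres m q homeomorphic_space top_of_set (wedge_points m q)"
proof -
  let ?S = "sum_topology (\<lambda>_ :: nat. nsphere q) {..<m}"
  let ?pr = "wedge_proj (\<lambda>_ :: nat. base_point)"
  have W: "wedge_of_spheres m q = quotient_topology ?S ?pr"
    by (simp add: wedge_of_spheres_def wedge_topology_def base_point_def)
  \<comment> \<open>The index 0 for \<open>None\<close> is arbitrary, as all base points have the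
    same image.\<close>
  define F where "F = (\<lambda>y. case y of None \<Rightarrow> wedge_emb m 0 base_point | Some (k, p) \<Rightarrow> wedge_emb m k p)"
  have F: "F (?pr (k, p)) = wedge_emb m k p" for k p
    using wedge_emb_base by (auto simp: F_def wedge_proj_def)
  have top: "topspace (wedge_of_spheres m q) = ?pr ` ({..<m} \<times> sphere_points q)"
    by (auto simp: W nsphere_eq_top_of_set)
  have "homeomorphic_map (wedge_of_spheres m q) (top_of_set (wedge_points m q)) F"
  proof (rule continuous_imp_homeomorphic_map)
    show "compact_space (wedge_of_spheres m q)" by (rule compact_space_wedge_of_spheres)
    show "Hausdorff_space (top_of_set (wedge_points m q))"
      by (simp add: Hausdorff_space_subtopology)
    have "continuous_map ?S (top_of_set (wedge_points m q)) (F \<circ> ?pr)"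
    proof -
      have "continuous_map (nsphere q) (top_of_set (wedge_points m q)) (wedge_emb m k)" if "k < m" for k
        using that continuous_on_wedge_emb by (auto simp: nsphere_eq_top_of_set wedge_points_def)
      moreover have "wedge_emb m k p \<in> wedge_points m q" if "k < m" "p \<in> sphere_points q" for k p
        using that by (auto simp: wedge_points_def)
      ultimately show ?thesis
        by (auto simp: continuous_map_def openin_sum_topology F nsphere_eq_top_of_set)
    qed
    then show "continuous_map (wedge_of_spheres m q) (top_of_set (wedge_points m q)) F"
      unfolding W by (rule continuous_compose_quotient_map[OF quotient_map_quotient_topology])
    show "F ` topspace (wedge_of_spheres m q) = topspace (top_of_set (wedge_points m q))"
      unfolding top by (force simp: image_image F wedge_points_def split: prod.splits)
    show "inj_on F (topspace (wedge_of_spheres m q))"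
      unfolding top
    proof (rule inj_onI; clarsimp simp: F)
      fix j p k p'
      assume "j < m" "k < m" "wedge_emb m j p = wedge_emb m k p'"
      then show "?pr (j, p) = ?pr (k, p')"
        using wedge_emb_eqD by (fastforce simp: wedge_proj_def)
    qed
  qed
  then show ?thesis using homeomorphic_map_imp_homeomorphic_space by blast
qed

section \<open>Shearing the exceptional rays into a plane\<close>

text \<open>Modulo constants on each copy of \<open>{1..n}\<close>, these are the rays from the origin through the
  barycentres of the missing facets.\<close>

definition exceptional :: "nat \<Rightarrow> (nat \<times> bool \<Rightarrow> real) set" where
  "exceptional n = {f. \<exists>i\<in>{1..n}. \<exists>s\<ge>0. \<exists>c. \<forall>j\<in>{1..n}. \<forall>b. f (j, b) = c b - (if j = i then s else 0)}"

lemma exceptional_shift: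
  assumes "\<And>j b. j \<in> {1..n} \<Longrightarrow> g (j, b) = f (j, b) + d b"
  shows "g \<in> exceptional n \<longleftrightarrow> f \<in> exceptional n"
proof -
  have "g \<in> exceptional n" if f: "f \<in> exceptional n" and g: "\<And>j b. j \<in> {1..n} \<Longrightarrow> g (j, b) = f (j, b) + d b"
    for f g and d :: "bool \<Rightarrow> real"
  proof -
    obtain i s c where *: "i \<in> {1..n}" "0 \<le> s" "\<forall>j\<in>{1..n}. \<forall>b. f (j, b) = c b - (if j = i then s else 0)"
      using f unfolding exceptional_def by blast
    have "\<forall>j\<in>{1..n}. \<forall>b. g (j, b) = (c b + d b) - (if j = i then s else 0)"
      using * g by simp
    then show ?thesis using *(1,2) unfolding exceptional_def
      by (intro CollectI bexI[of _ i] exI[of _ s] conjI exI[of _ "\<lambda>b. c b + d b"])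
  qed
  from this[of f g d] this[of g f "\<lambda>b. - d b"] show ?thesis using assms by auto
qed

text \<open>Coordinates on the product of two copies of R^n/R for n = m + 1: subtracting the value
  at the last vertex removes the constant of each copy. Here j counts from 0, the vertices from
  1.\<close>

definition rel :: "nat \<Rightarrow> (nat \<times> bool \<Rightarrow> real) \<Rightarrow> nat \<Rightarrow> bool \<Rightarrow> real" where
  "rel m f j b = f (Suc j, b) - f (Suc m, b)"

text \<open>Two linear forms chosen for their values on the rays: the ray of index
  \<open>Suc l\<close> with parameter s goes to (s, s * slope m l), and the ray of index
  \<open>Suc m\<close> goes to (- m * s, 0) because the slopes sum to 0.\<close>

definition plane :: "nat \<Rightarrow> (nat \<times> bool \<Rightarrow> real) \<Rightarrow> real \<times> real" where
  "plane m f = (- (\<Sum>j<m. rel m f j True),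
     rel m f 0 False - rel m f 0 True - (\<Sum>j<m. slope m j * rel m f j True))"

text \<open>The value that the coordinate \<open>rel m f j True\<close> takes on the exceptional rays, as a function of
  \<open>plane m f\<close>; subtracting it shears the rays into the plane.\<close>

definition bend :: "nat \<Rightarrow> nat \<Rightarrow> real \<times> real \<Rightarrow> real" where
  "bend m j z = max 0 (- fst z) / real m - max 0 (fst z - \<bar>snd z - slope m j * fst z\<bar>)"

text \<open>For 1 <= j < m, index 2 j - 1 holds the sheared coordinate of the first copy and index 2
  j the difference of the copies. The coordinates for j = 0 are determined by
  \<open>plane\<close>.\<close>

definition normal :: "nat \<Rightarrow> (nat \<times> bool \<Rightarrow> real) \<Rightarrow> nat \<Rightarrow> real" where
  "normal m f i =
     (if 1 \<le> i \<and> i \<le> 2 * (m - 1) then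
        if odd i then rel m f (Suc i div 2) True - bend m (Suc i div 2) (plane m f)
        else rel m f (i div 2) False - rel m f (i div 2) True
      else 0)"

definition to_star :: "nat \<Rightarrow> (nat \<times> bool \<Rightarrow> real) \<Rightarrow> (real \<times> real) \<times> (nat \<Rightarrow> real)" where
  "to_star m f = (plane m f, normal m f)"

text \<open>\<open>plus_coord\<close> and \<open>diff_coord\<close> invert the shear: for j = 0 they
  solve the two equations of \<open>plane\<close>, otherwise they read off
  \<open>normal\<close>.\<close>

definition plus_coord :: "nat \<Rightarrow> (real \<times> real) \<times> (nat \<Rightarrow> real) \<Rightarrow> nat \<Rightarrow> real" where
  "plus_coord m x j =
     (if j = 0 then - fst (fst x) - (\<Sum>k=1..<m. snd x (2 * k - 1) + bend m k (fst x))
      else snd x (2 * j - 1) + bend m j (fst x))"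

definition diff_coord :: "nat \<Rightarrow> (real \<times> real) \<times> (nat \<Rightarrow> real) \<Rightarrow> nat \<Rightarrow> real" where
  "diff_coord m x j =
     (if j = 0 then snd (fst x) + (\<Sum>k<m. slope m k * plus_coord m x k) else snd x (2 * j))"

definition from_star :: "nat \<Rightarrow> (real \<times> real) \<times> (nat \<Rightarrow> real) \<Rightarrow> nat \<times> bool \<Rightarrow> real" where
  "from_star m x = (\<lambda>(v, b). if 1 \<le> v \<and> v \<le> m
     then plus_coord m x (v - 1) + (if b then 0 else diff_coord m x (v - 1)) else 0)"

section \<open>Exceptional rays as the legs of the star\<close>

lemma sum_slope: "(\<Sum>j<m. slope m j) = 0"
proof -
  have "(\<Sum>j<k. 2 * real j - c) = real k * (real k - 1) - real k * c" for k and c :: real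
    by (induction k) (auto simp: algebra_simps)
  from this[where k = m and c = "real m - 1"] show ?thesis by (simp add: slope_def)
qed

lemma bend_neg: "0 \<le> s \<Longrightarrow> bend m j (- s, 0) = s / real m"
  by (simp add: bend_def)

text \<open>The tent around leg j has half-width s at abscissa s, while the other right-hand legs
  are at vertical distance at least 2 s there.\<close>

lemma bend_ray:
  assumes "0 \<le> s" shows "bend m j (s, s * slope m i) = - (if j = i then s else 0)"
proof (cases "j = i")
  case True
  then show ?thesis using assms by (simp add: bend_def mult.commute)
next
  case False
  have "\<bar>s * slope m i - slope m j * s\<bar> = s * (2 * \<bar>real i - real j\<bar>)"
  proof -
    have "s * slope m i - slope m j * s = s * (2 * (real i - real j))"
      by (simp add: slope_def algebra_simps)
    then show ?thesis using assms by (simp only: abs_mult abs_of_nonneg abs_numeral)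
  qed
  moreover have "s * 1 \<le> s * (2 * \<bar>real i - real j\<bar>)"
    using False assms by (intro mult_left_mono) (auto simp: abs_if)
  ultimately show ?thesis using False assms by (simp add: bend_def)
qed

lemma plane_eqD:
  assumes "0 < m" "plane m f = z"
  shows "rel m f 0 True = - fst z - (\<Sum>j=1..<m. rel m f j True)"
    and "rel m f 0 False - rel m f 0 True = snd z + (\<Sum>j<m. slope m j * rel m f j True)"
proof -
  have "(\<Sum>j<m. rel m f j True) = rel m f 0 True + (\<Sum>j=1..<m. rel m f j True)"
    using assms(1) by (simp add: lessThan_atLeast0 sum.atLeast_Suc_lessThan)
  then show "rel m f 0 True = - fst z - (\<Sum>j=1..<m. rel m f j True)"
    using assms(2) by (auto simp: plane_def)
  show "rel m f 0 False - rel m f 0 True = snd z + (\<Sum>j<m. slope m j * rel m f j True)"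
    using assms(2) by (auto simp: plane_def)
qed

lemma normal_odd: "1 \<le> j \<Longrightarrow> j < m \<Longrightarrow> normal m f (2 * j - 1) = rel m f j True - bend m j (plane m f)"
  by (auto simp: normal_def)

lemma normal_even: "1 \<le> j \<Longrightarrow> j < m \<Longrightarrow> normal m f (2 * j) = rel m f j False - rel m f j True"
  by (auto simp: normal_def)

lemma normal_eq_0:
  assumes "\<And>j. 1 \<le> j \<Longrightarrow> j < m \<Longrightarrow> rel m f j True = bend m j (plane m f) \<and> rel m f j False = rel m f j True"
  shows "normal m f = (\<lambda>_. 0)"
proof
  fix i
  show "normal m f i = 0"
  proof (cases "1 \<le> i \<and> i \<le> 2 * (m - 1)")
    case True
    then have "1 \<le> Suc i div 2 \<and> Suc i div 2 < m" "even i \<Longrightarrow> i div 2 = Suc i div 2" by auto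
    then show ?thesis using assms by (auto simp: normal_def)
  qed (auto simp: normal_def)
qed

lemma exceptional_to_star:
  assumes "0 < m" "f \<in> exceptional (Suc m)"
  shows "plane m f \<in> star m \<and> normal m f = (\<lambda>_. 0)"
proof -
  obtain i s c where i: "i \<in> {1..Suc m}" "0 \<le> s"
    and f: "\<And>j b. j \<in> {1..Suc m} \<Longrightarrow> f (j, b) = c b - (if j = i then s else 0)"
    using assms(2) unfolding exceptional_def by blast
  show ?thesis
  proof (cases "i = Suc m")
    case True
    then have r: "rel m f j b = s" if "j < m" for j b
      using that f[of "Suc j"] f[of "Suc m"] by (simp add: rel_def)
    then have p: "plane m f = (- (real m * s), 0)"
      using assms(1) sum_slope[of m] by (simp add: plane_def flip: sum_distrib_right)
    then have "plane m f \<in> star m" using i(2) by (auto simp: star_def intro!: exI[of _ "real m * s"])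
    moreover have "normal m f = (\<lambda>_. 0)"
      using i(2) assms(1) by (intro normal_eq_0) (simp add: p bend_neg r)
    ultimately show ?thesis ..
  next
    case False
    define l where "l = i - 1"
    have l: "l < m" "i = Suc l" using False i by (auto simp: l_def)
    have r: "rel m f j b = - (if j = l then s else 0)" if "j < m" for j b
      using that f[of "Suc j"] f[of "Suc m"] l by (simp add: rel_def)
    have "(\<Sum>j<m. rel m f j True) = - s" "(\<Sum>j<m. slope m j * rel m f j True) = - (slope m l * s)"
      using l(1) by (simp_all add: r sum_negf if_distrib[where f="\<lambda>x. _ * x"] cong: if_cong)
    then have p: "plane m f = (s, s * slope m l)"
      using assms(1) by (simp add: plane_def r)
    then have "plane m f \<in> star m" using i(2) l(1) by (auto simp: star_def)
    moreover have "normal m f = (\<lambda>_. 0)"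
      using i(2) by (intro normal_eq_0) (simp add: p bend_ray r)
    ultimately show ?thesis ..
  qed
qed

text \<open>Vanishing of \<open>normal\<close> gives every coordinate with j >= 1 its
  \<open>bend\<close> value; the equations of \<open>plane\<close> then force the same pattern for j
  = 0.\<close>

lemma to_star_exceptional:
  assumes "0 < m" "plane m f \<in> star m" and nrm: "normal m f = (\<lambda>_. 0)"
  shows "f \<in> exceptional (Suc m)"
proof -
  have F: "rel m f j False = rel m f j True" if "1 \<le> j" "j < m" for j
    using normal_even[OF that, of f] nrm by simp
  have T: "rel m f j True = bend m j (plane m f)" if "1 \<le> j" "j < m" for j
    using normal_odd[OF that, of f] nrm by simp
  obtain s where s: "0 \<le> s" "plane m f = (- s, 0) \<or> (\<exists>k<m. plane m f = (s, s * slope m k))"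
    using assms(2) by (auto simp: star_def)
  \<comment> \<open>The copies agree for j >= 1 by F. For j = 0 they agree because the
    slope-weighted sum cancels the second coordinate of \<open>plane\<close>.\<close>
  have all: "rel m f j b = g j" if "j < m" and T: "\<And>j. j < m \<Longrightarrow> rel m f j True = g j"
    and "snd (plane m f) + (\<Sum>j<m. slope m j * g j) = 0" for j b and g :: "nat \<Rightarrow> real"
  proof -
    have "rel m f 0 False - rel m f 0 True = 0"
      using plane_eqD(2)[OF assms(1) refl, of f] that(2,3) by simp
    then show ?thesis using that F[of j] by (cases "j = 0"; cases b) auto
  qed
  from s(2) show ?thesis
  proof (elim disjE exE conjE)
    assume p: "plane m f = (- s, 0)"
    \<comment> \<open>The last ray with parameter r is mapped to (- m * r, 0), hence the parameter s
      / m.\<close>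
    have "rel m f j True = s / real m" if "j < m" for j
    proof (cases "j = 0")
      case True
      have "rel m f 0 True = s - (\<Sum>j=1..<m. s / real m)"
        using plane_eqD(1)[OF assms(1) p] T by (simp add: p bend_neg s)
      also have "\<dots> = s / real m"
        using assms(1) by (simp add: field_simps of_nat_diff)
      finally show ?thesis using True by simp
    qed (use T that in \<open>simp add: p bend_neg s\<close>)
    then have r: "rel m f j b = s / real m" if "j < m" for j b
      using all[of j "\<lambda>_. s / real m" b] that sum_slope[of m] by (simp add: p flip: sum_distrib_right sum_divide_distrib)
    have "f (j, b) = (f (Suc m, b) + s / real m) - (if j = Suc m then s / real m else 0)" if "j \<in> {1..Suc m}" for j b
    proof (cases "j = Suc m")
      case False
      then have "j - 1 < m" using that by auto
      from r[OF this, of b] show ?thesis using that False by (simp add: rel_def)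
    qed simp
    then have "\<forall>j\<in>{1..Suc m}. \<forall>b. f (j, b) = (f (Suc m, b) + s / real m) - (if j = Suc m then s / real m else 0)"
      by blast
    moreover have "0 \<le> s / real m" "Suc m \<in> {1..Suc m}" using s(1) by auto
    ultimately show ?thesis unfolding exceptional_def
      by (intro CollectI bexI[of _ "Suc m"] exI[of _ "s / real m"] conjI exI[of _ "\<lambda>b. f (Suc m, b) + s / real m"])
  next
    fix k assume k: "k < m" and p: "plane m f = (s, s * slope m k)"
    have "rel m f j True = - (if j = k then s else 0)" if "j < m" for j
    proof (cases "j = 0")
      case True
      have "rel m f 0 True = - s + (\<Sum>j=1..<m. if j = k then s else 0)"
        using plane_eqD(1)[OF assms(1) p] T by (simp add: p bend_ray s sum_negf)
      also have "\<dots> = - (if 0 = k then s else 0)"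
        using k by (cases "k = 0") auto
      finally show ?thesis using True by simp
    qed (use T that in \<open>simp add: p bend_ray s\<close>)
    moreover have "(\<Sum>j<m. slope m j * - (if j = k then s else 0)) = - (s * slope m k)"
      using k by (simp add: if_distrib[where f="\<lambda>x. _ * x"] if_distrib[where f=uminus] cong: if_cong)
    ultimately have r: "rel m f j b = - (if j = k then s else 0)" if "j < m" for j b
      using all[of j "\<lambda>j. - (if j = k then s else 0)" b] that by (simp only: p snd_conv add.right_inverse)
    have "f (j, b) = f (Suc m, b) - (if j = Suc k then s else 0)" if j: "j \<in> {1..Suc m}" for j b
    proof (cases "j = Suc m")
      case False
      then obtain l where "j = Suc l" "l < m" using j by (cases j) auto
      then show ?thesis using r[of l b] by (simp add: rel_def)
    qed (use k in simp)
    then have "\<forall>j\<in>{1..Suc m}. \<forall>b. f (j, b) = f (Suc m, b) - (if j = Suc k then s else 0)"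
      by blast
    moreover have "Suc k \<in> {1..Suc m}" using k by auto
    ultimately show ?thesis unfolding exceptional_def using s(1)
      by (intro CollectI bexI[of _ "Suc k"] exI[of _ s] conjI exI[of _ "\<lambda>b. f (Suc m, b)"])
  qed
qed

section \<open>The shear and its inverse\<close>

lemma rel_from_star:
  assumes "j < m"
  shows "rel m (from_star m x) j True = plus_coord m x j"
    and "rel m (from_star m x) j False = plus_coord m x j + diff_coord m x j"
  using assms by (auto simp: rel_def from_star_def)

lemma to_from_star:
  assumes "0 < m" "x \<in> star_complement m (2 * (m - 1))"
  shows "to_star m (from_star m x) = x"
proof -
  obtain z w where x: "x = (z, w)" by (meson surj_pair)
  have "(\<Sum>j<m. plus_coord m x j) = - fst z"
    using assms(1) by (simp add: lessThan_atLeast0 sum.atLeast_Suc_lessThan plus_coord_def x)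
  moreover have "diff_coord m x 0 = snd z + (\<Sum>j<m. slope m j * plus_coord m x j)"
    by (simp add: diff_coord_def x)
  ultimately have p: "plane m (from_star m x) = z"
    using assms(1) by (simp add: plane_def rel_from_star)
  have "normal m (from_star m x) i = w i" for i
  proof (cases "1 \<le> i \<and> i \<le> 2 * (m - 1)")
    case True
    show ?thesis
    proof (cases "odd i")
      case odd: True
      then obtain k where "i = 2 * k + 1" using oddE by blast
      then show ?thesis using True odd p by (simp add: normal_def rel_from_star plus_coord_def x)
    next
      case False
      then obtain k where "i = 2 * k" using evenE by blast
      then have "i = 2 * k" "1 \<le> k" "k < m" using True by auto
      then show ?thesis using True by (simp add: normal_def rel_from_star diff_coord_def x)
    qed
  next
    case False
    then show ?thesis using assms(2) by (auto simp: normal_def star_complement_def x not_le)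
  qed
  then show ?thesis using p by (auto simp: to_star_def x)
qed

lemma from_to_star:
  assumes "0 < m" "j \<in> {1..Suc m}"
  shows "from_star m (to_star m f) (j, b) = f (j, b) - f (Suc m, b)"
proof -
  have P1: "plus_coord m (to_star m f) k = rel m f k True" if "1 \<le> k" "k < m" for k
    using that normal_odd[of k m f] by (simp add: plus_coord_def to_star_def)
  have P: "plus_coord m (to_star m f) k = rel m f k True" if "k < m" for k
  proof (cases "k = 0")
    case True
    have "(\<Sum>k=1..<m. normal m f (2 * k - 1) + bend m k (plane m f)) = (\<Sum>k=1..<m. rel m f k True)"
      using normal_odd[of _ m f] by (intro sum.cong) auto
    then show ?thesis
      using plane_eqD(1)[OF assms(1) refl, of f] True by (simp add: plus_coord_def to_star_def)
  qed (use P1 that in auto)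
  have "diff_coord m (to_star m f) k = rel m f k False - rel m f k True" if "k < m" for k
    using that normal_even[of k m f] plane_eqD(2)[OF assms(1) refl, of f] P
    by (cases "k = 0") (auto simp: diff_coord_def to_star_def)
  then show ?thesis
    using P[of "j - 1"] assms(2) by (cases "j = Suc m") (auto simp: from_star_def rel_def)
qed

lemma continuous_on_rel [continuous_intros]: "continuous_on S (\<lambda>f. rel m f j b)"
  unfolding rel_def by (intro continuous_intros)

lemma continuous_on_bend [continuous_intros]:
  "0 < m \<Longrightarrow> continuous_on S g \<Longrightarrow> continuous_on S (\<lambda>x. bend m j (g x))"
  unfolding bend_def by (intro continuous_intros) auto

lemma continuous_on_plane [continuous_intros]: "continuous_on S (plane m)"
  unfolding plane_def by (intro continuous_intros)

lemma continuous_on_to_star: "0 < m \<Longrightarrow> continuous_on S (to_star m)"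
  unfolding to_star_def
proof (intro continuous_on_Pair continuous_on_plane continuous_on_coordinatewise_then_product)
  fix i assume m: "0 < m"
  show "continuous_on S (\<lambda>f. normal m f i)"
    using m unfolding normal_def
    by (cases "1 \<le> i \<and> i \<le> 2 * (m - 1)"; cases "odd i") (auto intro!: continuous_intros)
qed

lemma continuous_on_from_star:
  assumes "0 < m" shows "continuous_on S (from_star m)"
proof (rule continuous_on_coordinatewise_then_product)
  fix v :: "nat \<times> bool"
  obtain j b where v: "v = (j, b)" by force
  have P: "continuous_on S (\<lambda>x. plus_coord m x j)" for j
    using assms unfolding plus_coord_def by (cases "j = 0") (auto intro!: continuous_intros)
  then have "continuous_on S (\<lambda>x. diff_coord m x j)" for j
    unfolding diff_coord_def by (cases "j = 0") (auto intro!: continuous_intros)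
  then show "continuous_on S (\<lambda>x. from_star m x v)"
    unfolding from_star_def v prod.case using P
    by (cases "1 \<le> j \<and> j \<le> m"; cases b) (auto intro!: continuous_intros)
qed

lemma nonexceptional_homotopy_equivalent_star_complement:
  assumes "0 < m"
  shows "top_of_set (- exceptional (Suc m))
    homotopy_equivalent_space top_of_set (star_complement m (2 * (m - 1)))"
proof (rule deformation_retraction_imp_homotopy_equivalent_space)
  let ?E = "- exceptional (Suc m)" and ?P = "star_complement m (2 * (m - 1))"
  have to: "to_star m f \<in> ?P" if "f \<in> ?E" for f
    using to_star_exceptional[OF assms, of f] that
    by (auto simp: star_complement_def to_star_def fun_eq_iff) (auto simp: normal_def)
  have "from_star m x \<in> ?E" if "x \<in> ?P" for x
  proof
    assume "from_star m x \<in> exceptional (Suc m)"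
    from exceptional_to_star[OF assms this] to_from_star[OF assms that] that show False
      by (auto simp: star_complement_def to_star_def)
  qed
  then show "retraction_maps (top_of_set ?E) (top_of_set ?P) (to_star m) (from_star m)"
    using to continuous_on_to_star[OF assms] continuous_on_from_star[OF assms] to_from_star[OF assms]
    by (auto simp: retraction_maps_def)
  show "homotopic_with (\<lambda>x. True) (top_of_set ?E) (top_of_set ?E) (from_star m \<circ> to_star m) id"
  proof (rule homotopic_with_top_of_setI)
    let ?h = "\<lambda>a v. (1 - fst a) * from_star m (to_star m (snd a)) v + fst a * snd a v"
    have "continuous_on ({0..1 :: real} \<times> ?E) (\<lambda>a. from_star m (to_star m (snd a)))"
      by (intro continuous_on_compose2[OF continuous_on_from_star[OF assms]]
          continuous_on_compose2[OF continuous_on_to_star[OF assms]] continuous_intros) auto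
    from continuous_on_product_then_coordinatewise[OF this]
    show "continuous_on ({0..1} \<times> ?E) ?h"
      by (intro continuous_on_coordinatewise_then_product continuous_intros)
    \<comment> \<open>On the vertices the path is f shifted on copy b by the constant
      \<open>(t - 1) * f (Suc m, b)\<close>, and \<open>exceptional\<close> is invariant under such
      shifts.\<close>
    show "?h (t, f) \<in> ?E" if "f \<in> ?E" for t f
      using exceptional_shift[of "Suc m" "?h (t, f)" f "\<lambda>b. (t - 1) * f (Suc m, b)"] that
        from_to_star[OF assms, of _ f]
      by (simp add: algebra_simps)
  qed auto
qed

section \<open>The total 2-cut complex of the prism\<close>

lemma continuous_on_Min_image:
  fixes g :: "'i \<Rightarrow> 'a::topological_space \<Rightarrow> real"
  assumes "finite I" "I \<noteq> {}" "\<And>i. i \<in> I \<Longrightarrow> continuous_on S (g i)"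
  shows "continuous_on S (\<lambda>x. Min ((\<lambda>i. g i x) ` I))"
  using assms
proof (induction rule: finite_ne_induct)
  case (insert i I)
  then show ?case by (auto intro!: continuous_intros)
qed simp

text \<open>The realization of the complex in barycentric coordinates; the two vanishing coordinates
  are a nonadjacent pair omitted by a face that carries f.\<close>

definition cut_points :: "nat \<Rightarrow> (nat \<times> bool \<Rightarrow> real) set" where
  "cut_points n = {f. (\<forall>v. 0 \<le> f v) \<and> (\<forall>v. v \<notin> prism_verts n \<longrightarrow> f v = 0) \<and>
     (\<exists>i\<in>{1..n}. \<exists>j\<in>{1..n}. i \<noteq> j \<and> f (i, True) = 0 \<and> f (j, False) = 0) \<and>
     (\<Sum>v\<in>prism_verts n. f v) = 1}"

text \<open>Normalises each copy to minimum 0, so that whatever is built from it depends on f only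
  modulo constants on each copy.\<close>

definition excess :: "nat \<Rightarrow> (nat \<times> bool \<Rightarrow> real) \<Rightarrow> nat \<times> bool \<Rightarrow> real" where
  "excess n f v = f v - Min ((\<lambda>j. f (j, snd v)) ` {1..n})"

text \<open>Subtracting the depth and truncating at 0 pushes a point of a missing facet radially away from
  its barycentre, until the coordinates of some nonadjacent pair of vertices vanish.\<close>

definition depth :: "nat \<Rightarrow> (nat \<times> bool \<Rightarrow> real) \<Rightarrow> real" where
  "depth n f = Min ((\<lambda>p. max (excess n f (fst p, True)) (excess n f (snd p, False))) `
     {p \<in> {1..n} \<times> {1..n}. fst p \<noteq> snd p})"

definition lower :: "nat \<Rightarrow> (nat \<times> bool \<Rightarrow> real) \<Rightarrow> nat \<times> bool \<Rightarrow> real" where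
  "lower n f v = (if v \<in> prism_verts n then max 0 (excess n f v - depth n f) else 0)"

definition lower_sum :: "nat \<Rightarrow> (nat \<times> bool \<Rightarrow> real) \<Rightarrow> real" where
  "lower_sum n f = (\<Sum>v\<in>prism_verts n. lower n f v)"

definition cut_retraction :: "nat \<Rightarrow> (nat \<times> bool \<Rightarrow> real) \<Rightarrow> nat \<times> bool \<Rightarrow> real" where
  "cut_retraction n f v = lower n f v / lower_sum n f"

section \<open>Retraction onto the realization of the complex\<close>

lemma finite_prism_verts [simp]: "finite (prism_verts n)"
  by (simp add: prism_verts_def)

lemma prism_verts_iff [simp]: "(j, b) \<in> prism_verts n \<longleftrightarrow> 1 \<le> j \<and> j \<le> n"
  by (simp add: prism_verts_def)

lemma excess_nonneg: "j \<in> {1..n} \<Longrightarrow> 0 \<le> excess n f (j, b)"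
  by (auto simp: excess_def)

lemma excess_zero:
  assumes "1 \<le> n" obtains j where "j \<in> {1..n}" "excess n f (j, b) = 0"
proof -
  have "Min ((\<lambda>j. f (j, b)) ` {1..n}) \<in> (\<lambda>j. f (j, b)) ` {1..n}"
    using assms by (intro Min_in) auto
  then show ?thesis using that by (auto simp: excess_def)
qed

lemma depth_le:
  assumes "i \<in> {1..n}" "j \<in> {1..n}" "i \<noteq> j"
  shows "depth n f \<le> max (excess n f (i, True)) (excess n f (j, False))"
  unfolding depth_def using assms by (intro Min_le) (auto intro!: image_eqI[of _ _ "(i, j)"])

lemma pair_index: "2 \<le> n \<Longrightarrow> (1, 2) \<in> {p \<in> {1..n} \<times> {1..n}. fst p \<noteq> (snd p :: nat)}"
  by auto

lemma depth_attained:
  assumes "2 \<le> n"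
  obtains i j where "i \<in> {1..n}" "j \<in> {1..n}" "i \<noteq> j"
    "depth n f = max (excess n f (i, True)) (excess n f (j, False))"
proof -
  have "{p \<in> {1..n} \<times> {1..n}. fst p \<noteq> snd p} \<noteq> {}"
    by (rule ccontr) (use pair_index[OF assms] in blast)
  then have "depth n f \<in> (\<lambda>p. max (excess n f (fst p, True)) (excess n f (snd p, False))) `
     {p \<in> {1..n} \<times> {1..n}. fst p \<noteq> snd p}"
    unfolding depth_def by (intro Min_in) (auto simp del: Collect_empty_eq)
  then show ?thesis using that by auto
qed

lemma depth_nonneg: "2 \<le> n \<Longrightarrow> 0 \<le> depth n f"
  by (metis depth_attained excess_nonneg max.coboundedI1)

lemma lower_nonneg: "0 \<le> lower n f v"
  by (simp add: lower_def)

lemma lower_sum_nonneg: "0 \<le> lower_sum n f"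
  by (simp add: lower_sum_def sum_nonneg lower_nonneg)

text \<open>Let p and q be indices of minima in the two copies. If they differ, they form a
  nonadjacent pair, the depth is 0 and f is constant on each copy. If p = q, pairing p with another
  j shows that the excess at j is at least the depth, hence equal to it.\<close>

lemma lower_sum_zero_exceptional:
  assumes "2 \<le> n" "lower_sum n f = 0" shows "f \<in> exceptional n"
proof -
  have le: "excess n f (j, b) \<le> depth n f" if "j \<in> {1..n}" for j b
  proof -
    have "lower n f (j, b) = 0"
      using assms(2) that by (simp add: lower_sum_def sum_nonneg_eq_0_iff lower_nonneg)
    then show ?thesis using that by (auto simp: lower_def split: if_splits)
  qed
  obtain p where p: "p \<in> {1..n}" "excess n f (p, True) = 0" using excess_zero[of n f True] assms(1) by auto
  obtain q where q: "q \<in> {1..n}" "excess n f (q, False) = 0" using excess_zero[of n f False] assms(1) by auto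
  have "excess n f (j, b) = (if j = p then 0 else depth n f)" if j: "j \<in> {1..n}" for j b
  proof (cases "p = q")
    case True
    show ?thesis
    proof (cases "j = p")
      case True
      then show ?thesis using p q \<open>p = q\<close> by (cases b) auto
    next
      case False
      have "depth n f \<le> excess n f (j, b)"
        using depth_le[OF p(1) j, of f] depth_le[OF j q(1), of f] excess_nonneg[OF j, of f] p q False \<open>p = q\<close>
        by (cases b) auto
      then show ?thesis using le[OF j, of b] False by simp
    qed
  next
    case False
    then have "depth n f \<le> 0" using depth_le[OF p(1) q(1), of f] p q by simp
    then show ?thesis using le[OF j, of b] excess_nonneg[OF j, of f b] depth_nonneg[OF assms(1), of f] by simp
  qed
  then have "\<forall>j\<in>{1..n}. \<forall>b. f (j, b) =
      Min ((\<lambda>j. f (j, b)) ` {1..n}) + depth n f - (if j = p then depth n f else 0)"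
    by (auto simp: excess_def algebra_simps)
  then show ?thesis
    unfolding exceptional_def using p(1) depth_nonneg[OF assms(1), of f]
    by (intro CollectI bexI[of _ p] exI[of _ "depth n f"] conjI
        exI[of _ "\<lambda>b. Min ((\<lambda>j. f (j, b)) ` {1..n}) + depth n f"])
qed

text \<open>The vanishing pair makes both minima and the depth 0, so nothing is subtracted.\<close>

lemma cut_points_lower:
  assumes "f \<in> cut_points n" shows "lower n f = f" "lower_sum n f = 1"
proof -
  obtain i j where ij: "i \<in> {1..n}" "j \<in> {1..n}" "i \<noteq> j" "f (i, True) = 0" "f (j, False) = 0"
    using assms by (auto simp: cut_points_def)
  have nn: "0 \<le> f v" for v using assms unfolding cut_points_def by blast
  have n: "2 \<le> n" using ij by auto
  have M: "Min ((\<lambda>j. f (j, b)) ` {1..n}) = 0" for b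
    using ij nn by (intro Min_eqI) (cases b; force)+
  then have e: "excess n f v = f v" for v by (simp add: excess_def)
  have "depth n f = 0"
    using depth_le[OF ij(1,2,3), of f] depth_nonneg[OF n, of f] ij by (simp add: e)
  then show "lower n f = f"
    using nn assms by (auto simp: lower_def e cut_points_def fun_eq_iff)
  then show "lower_sum n f = 1"
    using assms by (simp add: lower_sum_def cut_points_def)
qed

text \<open>On a ray all excesses are s except at index i. The indices of a nonadjacent pair are not
  both i, so the depth is at least s and truncation leaves nothing.\<close>

lemma exceptional_lower_sum:
  assumes "2 \<le> n" "f \<in> exceptional n" shows "lower_sum n f = 0"
proof -
  obtain i s c where i: "i \<in> {1..n}" "0 \<le> s"
    and f: "\<And>j b. j \<in> {1..n} \<Longrightarrow> f (j, b) = c b - (if j = i then s else 0)"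
    using assms(2) unfolding exceptional_def by blast
  have "Min ((\<lambda>j. f (j, b)) ` {1..n}) = c b - s" for b
  proof (rule Min_eqI)
    show "c b - s \<in> (\<lambda>j. f (j, b)) ` {1..n}" using i f[of i b] by force
  qed (use f i in \<open>auto split: if_splits\<close>)
  then have e: "excess n f (j, b) = (if j = i then 0 else s)" if "j \<in> {1..n}" for j b
    using f[OF that, of b] by (simp add: excess_def)
  have "s \<le> depth n f"
    using depth_attained[OF assms(1), of f] i(2) by (metis e max.coboundedI1 max.coboundedI2 order_refl)
  then have "lower n f v = 0" for v
    using i(2) by (cases v) (auto simp: lower_def e)
  then show ?thesis by (simp add: lower_sum_def)
qed

lemma cut_points_nonexceptional: "f \<in> cut_points n \<Longrightarrow> f \<notin> exceptional n"
  using exceptional_lower_sum[of n f] cut_points_lower(2)[of f n] by (force simp: cut_points_def)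

text \<open>A pair attaining the depth has both excesses at most the depth, so truncation makes both
  coordinates 0.\<close>

lemma cut_retraction_in:
  assumes "2 \<le> n" "f \<notin> exceptional n" shows "cut_retraction n f \<in> cut_points n"
proof -
  have pos: "0 < lower_sum n f"
    using lower_sum_zero_exceptional[OF assms(1)] assms(2) lower_sum_nonneg[of n f] by force
  obtain i j where ij: "i \<in> {1..n}" "j \<in> {1..n}" "i \<noteq> j"
    "depth n f = max (excess n f (i, True)) (excess n f (j, False))"
    using depth_attained[OF assms(1)] by metis
  then have "lower n f (i, True) = 0" "lower n f (j, False) = 0" by (auto simp: lower_def)
  moreover have "(\<Sum>v\<in>prism_verts n. cut_retraction n f v) = 1"
    using pos by (simp add: cut_retraction_def lower_sum_def flip: sum_divide_distrib)
  moreover have "cut_retraction n f v = 0" if "v \<notin> prism_verts n" for v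
    using that by (simp add: cut_retraction_def lower_def)
  moreover have "0 \<le> cut_retraction n f v" for v
    using pos by (simp add: cut_retraction_def lower_nonneg)
  moreover have "cut_retraction n f (i, True) = 0" "cut_retraction n f (j, False) = 0"
    using calculation(1,2) by (simp_all add: cut_retraction_def)
  ultimately show ?thesis
    unfolding cut_points_def using ij(1-3) by blast
qed

lemma cut_retraction_segment:
  assumes n: "2 \<le> n" and f: "f \<notin> exceptional n" and t: "0 \<le> t" "t \<le> 1"
  shows "(\<lambda>v. (1 - t) * cut_retraction n f v + t * f v) \<notin> exceptional n"
proof (cases "t = 0")
  case True
  then show ?thesis using cut_points_nonexceptional[OF cut_retraction_in[OF n f]] by simp
next
  case False
  \<comment> \<open>On each copy of \<open>{1..n}\<close> the segment applies a strictly increasing function to the coordinates,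
    so it can only meet an exceptional ray if it started on one.\<close>
  define \<phi> where "\<phi> b x = (1 - t) / lower_sum n f * max 0 (x - Min ((\<lambda>j. f (j, b)) ` {1..n}) - depth n f) + t * x" for b x
  have mono: "\<phi> b x < \<phi> b y \<longleftrightarrow> x < y" for b x y
  proof -
    have "\<phi> b x < \<phi> b y" if "x < y" for x y
      unfolding \<phi>_def using that t False lower_sum_nonneg[of n f]
      by (intro add_le_less_mono mult_left_mono mult_strict_left_mono) auto
    then show ?thesis by (metis less_asym less_irrefl linorder_less_linear)
  qed
  then have inj: "\<phi> b x = \<phi> b y \<longleftrightarrow> x = y" for b x y by (metis less_irrefl linorder_less_linear)
  have eq: "(1 - t) * cut_retraction n f (j, b) + t * f (j, b) = \<phi> b (f (j, b))" if "j \<in> {1..n}" for j b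
    using that by (simp add: cut_retraction_def lower_def excess_def \<phi>_def)
  show ?thesis
  proof
    assume "(\<lambda>v. (1 - t) * cut_retraction n f v + t * f v) \<in> exceptional n"
    then obtain i s c where i: "i \<in> {1..n}" "0 \<le> s"
      and c: "\<And>j b. j \<in> {1..n} \<Longrightarrow> \<phi> b (f (j, b)) = c b - (if j = i then s else 0)"
      unfolding exceptional_def using eq by auto
    obtain k where k: "k \<in> {1..n}" "k \<noteq> i"
    proof (cases "i = 1")
      case True then show ?thesis using that[of 2] n by auto
    next
      case False then show ?thesis using that[of 1] n by auto
    qed
    have const: "f (j, b) = f (k, b)" if "j \<in> {1..n}" "j \<noteq> i" for j b
    proof -
      have "\<phi> b (f (j, b)) = \<phi> b (f (k, b))" using c[OF that(1), of b] c[OF k(1), of b] that k by simp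
      then show ?thesis using inj by blast
    qed
    define d where "d b = f (k, b) - f (i, b)" for b
    have le: "0 \<le> d b" for b
      using c[OF i(1), of b] c[OF k(1), of b] k i(2) mono[of b "f (k, b)" "f (i, b)"] by (simp add: d_def)
    have M: "Min ((\<lambda>j. f (j, b)) ` {1..n}) = f (i, b)" for b
    proof (rule Min_eqI)
      show "f (i, b) \<le> y" if "y \<in> (\<lambda>j. f (j, b)) ` {1..n}" for y
        using that const[of _ b] le[of b] by (force simp: d_def)
    qed (use i in auto)
    \<comment> \<open>Up to shifts by \<open>f (i, b)\<close> in the argument and by a constant in
      the value, the maps of both copies are this one function. It is strictly increasing, so the
      gaps d of both copies agree and f lies on a ray.\<close>
    define \<psi> where "\<psi> x = (1 - t) / lower_sum n f * max 0 (x - depth n f) + t * x" for x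
    have \<psi>: "\<psi> (d b) = s + \<psi> 0" for b
    proof -
      have "\<phi> b x = \<psi> (x - f (i, b)) + t * f (i, b)" for x
        unfolding \<phi>_def \<psi>_def M by (simp add: algebra_simps)
      from this[of "f (i, b)"] this[of "f (k, b)"] show ?thesis
        using c[OF i(1), of b] c[OF k(1), of b] k by (simp add: d_def)
    qed
    have "\<psi> x < \<psi> y" if "x < y" for x y
      unfolding \<psi>_def using that t False lower_sum_nonneg[of n f]
      by (intro add_le_less_mono mult_left_mono mult_strict_left_mono) auto
    then have "d True = d False"
      using \<psi>[of True] \<psi>[of False] by (metis less_irrefl linorder_less_linear)
    then have dT: "d True = d b" for b by (cases b) auto
    have "f (j, b) = f (k, b) - (if j = i then d True else 0)" if "j \<in> {1..n}" for j b
      using const[OF that, of b] unfolding dT[of b] by (auto simp: d_def)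
    then have "\<forall>j\<in>{1..n}. \<forall>b. f (j, b) = f (k, b) - (if j = i then d True else 0)" by blast
    then have "f \<in> exceptional n"
      unfolding exceptional_def using i(1) le[of True]
      by (intro CollectI bexI[of _ i] exI[of _ "d True"] conjI exI[of _ "\<lambda>b. f (k, b)"])
    then show False using f by simp
  qed
qed

lemma continuous_on_excess:
  assumes "1 \<le> n" shows "continuous_on S (\<lambda>f. excess n f v)"
  unfolding excess_def using assms by (intro continuous_intros continuous_on_Min_image) auto

lemma continuous_on_cut_retraction:
  assumes "2 \<le> n" shows "continuous_on (- exceptional n) (cut_retraction n)"
proof (rule continuous_on_coordinatewise_then_product)
  fix v
  have "{p \<in> {1..n} \<times> {1..n}. fst p \<noteq> snd p} \<noteq> {}"
    by (rule ccontr) (use pair_index[OF assms] in blast)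
  then have "continuous_on S (depth n)" for S
    unfolding depth_def using assms
    by (intro continuous_on_Min_image continuous_intros continuous_on_excess) (auto simp del: Collect_empty_eq)
  then have "continuous_on S (\<lambda>f. lower n f v)" for v S
    unfolding lower_def using assms
    by (cases "v \<in> prism_verts n") (auto intro!: continuous_intros continuous_on_excess)
  then show "continuous_on (- exceptional n) (\<lambda>f. cut_retraction n f v)"
    unfolding cut_retraction_def
    using lower_sum_zero_exceptional[OF assms] by (intro continuous_intros) (auto simp: lower_sum_def intro!: continuous_intros)
qed

lemma nonexceptional_homotopy_equivalent_cut_points:
  assumes "2 \<le> n"
  shows "top_of_set (- exceptional n) homotopy_equivalent_space top_of_set (cut_points n)"
proof (rule deformation_retract_imp_homotopy_equivalent_space)
  show "retraction_maps (top_of_set (- exceptional n)) (top_of_set (cut_points n)) (cut_retraction n) id"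
    using continuous_on_cut_retraction[OF assms] cut_retraction_in[OF assms] cut_points_nonexceptional cut_points_lower
    by (auto simp: retraction_maps_def cut_retraction_def fun_eq_iff)
  show "homotopic_with (\<lambda>x. True) (top_of_set (- exceptional n)) (top_of_set (- exceptional n)) (cut_retraction n) id"
  proof (rule homotopic_with_top_of_setI)
    let ?h = "\<lambda>a v. (1 - fst a) * cut_retraction n (snd a) v + fst a * snd a v"
    have "continuous_on ({0..1 :: real} \<times> - exceptional n) (\<lambda>a. cut_retraction n (snd a))"
      by (intro continuous_on_compose2[OF continuous_on_cut_retraction[OF assms]] continuous_intros) auto
    from continuous_on_product_then_coordinatewise[OF this]
    show "continuous_on ({0..1} \<times> - exceptional n) ?h"
      by (intro continuous_on_coordinatewise_then_product continuous_intros)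
    show "?h (t, f) \<in> - exceptional n" if "0 \<le> t" "t \<le> 1" "f \<in> - exceptional n" for t f
      using cut_retraction_segment[OF assms _ that(1,2), of f] that(3) by simp
  qed auto
qed

section \<open>Facets, realization and dimension of the prism complex\<close>

lemma prism_cut_facets:
  "total_2cut_facets (prism_verts n) (prism_edges n) =
   {prism_verts n - {(i, True), (j, False)} | i j. i \<in> {1..n} \<and> j \<in> {1..n} \<and> i \<noteq> j}"
  (is "_ = ?F")
  unfolding total_2cut_facets_def
proof (intro set_eqI iffI; elim CollectE exE conjE; hypsubst?)
  fix a b
  assume ab: "a \<in> prism_verts n" "b \<in> prism_verts n" "a \<noteq> b" "{a, b} \<notin> prism_edges n"
  obtain i s j t where eq: "a = (i, s)" "b = (j, t)" by (meson surj_pair)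
  have ij: "i \<in> {1..n}" "j \<in> {1..n}" using ab eq by auto
  \<comment> \<open>Each copy is complete, and equal indices in opposite copies are joined by a
    rung, so a nonadjacent pair differs in both sign and index.\<close>
  have "s \<noteq> t"
  proof
    assume "s = t"
    then have "i \<noteq> j" using ab eq by auto
    then consider "i < j" | "j < i" by linarith
    then have "{a, b} \<in> prism_edges n"
    proof cases
      case 1
      then have "{a, b} \<in> {{(i, s), (j, s)} | i j s. 1 \<le> i \<and> i < j \<and> j \<le> n}"
        using ij \<open>s = t\<close> eq by (intro CollectI exI[of _ i] exI[of _ j] exI[of _ s]) simp
      then show ?thesis unfolding prism_edges_def by (rule UnI1)
    next
      case 2
      then have "{a, b} \<in> {{(i, s), (j, s)} | i j s. 1 \<le> i \<and> i < j \<and> j \<le> n}"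
        using ij \<open>s = t\<close> eq by (intro CollectI exI[of _ j] exI[of _ i] exI[of _ s]) (simp add: insert_commute)
      then show ?thesis unfolding prism_edges_def by (rule UnI1)
    qed
    then show False using ab by simp
  qed
  moreover have "i \<noteq> j"
  proof
    assume "i = j"
    then have "{a, b} = {(i, True), (i, False)}" using \<open>s \<noteq> t\<close> eq by (cases s; cases t) auto
    moreover have "{(i, True), (i, False)} \<in> {{(i, True), (i, False)} | i. 1 \<le> i \<and> i \<le> n}"
      using ij by (intro CollectI exI[of _ i]) simp
    ultimately show False using ab unfolding prism_edges_def by simp
  qed
  ultimately have "{a, b} = {(i, True), (j, False)} \<or> {a, b} = {(j, True), (i, False)}"
    using eq by (cases s; cases t) auto
  then show "prism_verts n - {a, b} \<in> ?F"
  proof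
    assume "{a, b} = {(i, True), (j, False)}"
    then show ?thesis using ij \<open>i \<noteq> j\<close> by (intro CollectI exI[of _ i] exI[of _ j]) simp
  next
    assume "{a, b} = {(j, True), (i, False)}"
    then show ?thesis using ij \<open>i \<noteq> j\<close> by (intro CollectI exI[of _ j] exI[of _ i]) simp
  qed
next
  fix i j assume ij: "i \<in> {1..n}" "j \<in> {1..n}" "i \<noteq> j"
  have "{(i, True), (j, False)} \<notin> prism_edges n"
    using ij by (auto simp: prism_edges_def doubleton_eq_iff)
  then show "prism_verts n - {(i, True), (j, False)} \<in> {prism_verts n - {a, b} | a b.
      a \<in> prism_verts n \<and> b \<in> prism_verts n \<and> a \<noteq> b \<and> {a, b} \<notin> prism_edges n}"
    using ij by (intro CollectI exI[of _ "(i, True)"] exI[of _ "(j, False)"]) auto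
qed

lemma prism_cut_complex:
  "total_2cut_complex (prism_verts n) (prism_edges n) =
   {\<sigma>. \<exists>i\<in>{1..n}. \<exists>j\<in>{1..n}. i \<noteq> j \<and> \<sigma> \<subseteq> prism_verts n - {(i, True), (j, False)}}"
  unfolding total_2cut_complex_def prism_cut_facets by blast

lemma realization_prism_cut_complex:
  "geometric_realization (total_2cut_complex (prism_verts n) (prism_edges n)) = top_of_set (cut_points n)"
proof -
  let ?V = "prism_verts n" and ?K = "total_2cut_complex (prism_verts n) (prism_edges n)"
  have supp: "{v. f v \<noteq> 0} \<in> ?K \<longleftrightarrow> (\<forall>v. v \<notin> ?V \<longrightarrow> f v = 0) \<and>
      (\<exists>i\<in>{1..n}. \<exists>j\<in>{1..n}. i \<noteq> j \<and> f (i, True) = 0 \<and> f (j, False) = 0)" for f :: "nat \<times> bool \<Rightarrow> real"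
    unfolding prism_cut_complex by blast
  have sum: "(\<Sum>v\<in>{v. f v \<noteq> 0}. f v) = (\<Sum>v\<in>?V. f v)" if "\<forall>v. v \<notin> ?V \<longrightarrow> f v = 0" for f :: "nat \<times> bool \<Rightarrow> real"
    using that by (intro sum.mono_neutral_left) auto
  have "{f. (\<forall>v. 0 \<le> f v) \<and> {v. f v \<noteq> 0} \<in> ?K \<and> (\<Sum>v\<in>{v. f v \<noteq> 0}. f v) = 1} = cut_points n"
    unfolding supp cut_points_def using sum by auto
  then show ?thesis
    unfolding geometric_realization_def by (simp add: euclidean_product_topology)
qed

lemma complex_dim_prism_cut_complex:
  assumes "2 \<le> n"
  shows "complex_dim (total_2cut_complex (prism_verts n) (prism_edges n)) = 2 * int n - 3"
proof -
  let ?V = "prism_verts n" and ?K = "total_2cut_complex (prism_verts n) (prism_edges n)"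
  have card: "card ?V = 2 * n" by (simp add: prism_verts_def card_cartesian_product)
  have F: "card (?V - {(i, True), (j, False)}) = 2 * n - 2" if "i \<in> {1..n}" "j \<in> {1..n}" for i j
    using that card by (subst card_Diff_subset) auto
  have "Max (card ` ?K) = 2 * n - 2"
  proof (rule Max_eqI)
    have "?K \<subseteq> Pow ?V" unfolding prism_cut_complex by blast
    moreover have "finite (Pow ?V)" by (simp add: prism_verts_def)
    ultimately show "finite (card ` ?K)" by (metis finite_imageI finite_subset)
    show "k \<le> 2 * n - 2" if k: "k \<in> card ` ?K" for k
    proof -
      obtain \<sigma> i j where \<sigma>: "k = card \<sigma>" "i \<in> {1..n}" "j \<in> {1..n}" "\<sigma> \<subseteq> ?V - {(i, True), (j, False)}"
        using k unfolding prism_cut_complex by blast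
      have "card \<sigma> \<le> card (?V - {(i, True), (j, False)})" using \<sigma>(4) by (intro card_mono) auto
      then show ?thesis using F[OF \<sigma>(2,3)] \<sigma>(1) by simp
    qed
    have "?V - {(1, True), (2, False)} \<in> ?K"
      unfolding prism_cut_complex using assms by (intro CollectI bexI[of _ 1] bexI[of _ 2]) auto
    moreover have "card (?V - {(1, True), (2, False)}) = 2 * n - 2" using assms by (intro F) auto
    ultimately show "2 * n - 2 \<in> card ` ?K" by (metis image_eqI)
  qed
  then show ?thesis using assms by (simp add: complex_dim_def of_nat_diff)
qed

theorem theorem4p8:
  fixes n :: nat
  assumes "n \<ge> 2"
  shows "complex_dim (total_2cut_complex (prism_verts n) (prism_edges n)) = 2 * int n - 3 \<and>
    geometric_realization (total_2cut_complex (prism_verts n) (prism_edges n))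
      homotopy_equivalent_space wedge_of_spheres (n - 1) (2 * n - 4)"
proof
  \<comment> \<open>The star has m + 1 = n legs, hence m sectors besides the base sector, one for
    each sphere.\<close>
  define m where "m = n - 1"
  have m: "0 < m" "n = Suc m" "2 * n - 4 = 2 * (m - 1)" using assms by (auto simp: m_def)
  have "top_of_set (cut_points n) homotopy_equivalent_space top_of_set (- exceptional n)"
    using nonexceptional_homotopy_equivalent_cut_points[OF assms] homotopy_equivalent_space_sym by blast
  also have "\<dots> homotopy_equivalent_space top_of_set (star_complement m (2 * (m - 1)))"
    using nonexceptional_homotopy_equivalent_star_complement[OF m(1)] by (simp add: m(2))
  also have "\<dots> homotopy_equivalent_space top_of_set (wedge_points m (2 * (m - 1)))"
    by (rule star_complement_homotopy_equivalent_wedge[OF m(1)])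
  also have "\<dots> homotopy_equivalent_space wedge_of_spheres m (2 * (m - 1))"
    using wedge_of_spheres_homeomorphic[OF m(1)] homeomorphic_imp_homotopy_equivalent_space
      homotopy_equivalent_space_sym by blast
  finally show "geometric_realization (total_2cut_complex (prism_verts n) (prism_edges n))
      homotopy_equivalent_space wedge_of_spheres (n - 1) (2 * n - 4)"
    by (simp add: realization_prism_cut_complex m(3) m_def)
qed (rule complex_dim_prism_cut_complex[OF assms])

end
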